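(* Let $n\ge 1$. The map $D\mapsto I_D$ is a poset isomorphism between $(\mathcal D_n,\ge)$, the set of Dyck paths of length $n$ with the reversed order, and the set of two-sided ideals of $\mathbb{C}A_n$ without idempotents, ordered by inclusion. (That is, it is a bijection, and $D\ge D'$ if and only if $I_D\subseteq I_{D'}$.) Moreover, for each $D\in\mathcal D_n$, the indecomposable modules of $\mathbb{C}A_n/I_D$ (up to isomorphism) are in one-to-one correspondence with the off-diagonal points on and below $D$, i.e. with the lattice points $(i,j)$, $1\le i\le j\le n$, lying on or below $D$.
   Context: **Path algebra.** $A_n$ is the linearly oriented quiver $1\leftarrow 2\leftarrow\cdots\leftarrow n$ with arrows $\alpha_i: i+1\to i$ ($1\le i\le n-1$) and trivial paths $e_1,\dots,e_n$. The path algebra $\mathbb{C}A_n$ has as basis all paths (the $e_i$ and the paths $\alpha_j\alpha_{j-1}\cdots\alpha_i$, $1\le i\le j\le n-1$, from vertex $j+1$ to vertex $i$), with multiplication given by concatenation; it is isomorphic to the algebra of upper triangular $n\times n$ matrices. Modules of $\mathbb{C}A_n/I$ are the (finite-dimensional) representations of $A_n$ satisfying the relations in $I$. The indecomposable $\mathbb{C}A_n$-modules are, up to isomorphism, the $M_{i,j}$ ($1\le i\le j\le n$), with $\mathbb{C}$ at the vertices $i,i+1,\dots,j$, zero elsewhere, and identity maps between adjacent copies of $\mathbb{C}$. An ideal is "without idempotents" if it contains no nonzero idempotent (e.g. no $e_i$). **Dyck paths.** A Dyck path of length $n$ is a lattice path from $(1,0)$ to $(n+1,n)$ with $2n$ steps,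 each an up step $(i,j)\to(i,j+1)$ or a down step $(i,j)\to(i+1,j)$, all of whose vertices $(i,j)$ satisfy $j\ge i-1$. The points $(i,i-1)$ form the baseline (diagonal). Let $\mathcal D_n$ be the set of Dyck paths of length $n$. If the $i$-th down step of $D$ goes from $(i,k_i)$ to $(i+1,k_i)$, a point $(i,j)$ with $1\le i\le j\le n$ is on or below $D$ iff $j\le k_i$. The partial order is: $D\le D'$ iff $D$ lies on or below $D'$ (iff $k_i\le k_i'$ for all $i$). **The ideal $I_D$.** A valley of $D$ is a vertex of $D$ preceded by a down step and followed by an up step. For a valley $(a,b)$ let $p_{a,b}=\alpha_b\alpha_{b-1}\cdots\alpha_{a-1}$, the path from vertex $b+1$ to vertex $a-1$. Then $I_D$ is the two-sided ideal generated by all $p_{a,b}$ with $(a,b)$ a valley of $D$. *)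

theory Defs
  imports Complex_Main "HOL-Algebra.Ideal"
begin

section \<open>Dyck paths\<close>

datatype step = Up | Down

text \<open>A lattice path is the list of its steps; it starts at the point \<open>(1,0)\<close>.
  \<open>vertex D m\<close> is the point reached after the first \<open>m\<close> steps.\<close>

definition vertex :: "step list \<Rightarrow> nat \<Rightarrow> nat \<times> nat" where
  "vertex D m = (1 + count_list (take m D) Down, count_list (take m D) Up)"

definition dyck_paths :: "nat \<Rightarrow> step list set" where
  "dyck_paths n = {D. length D = 2 * n \<and> vertex D (2 * n) = (n + 1, n) \<and>
     (\<forall>m \<le> 2 * n. case vertex D m of (i, j) \<Rightarrow> i \<le> j + 1)}"

text \<open>The height \<open>k\<^sub>i\<close> of the \<open>i\<close>-th down step, which goes from \<open>(i, k\<^sub>i)\<close> to \<open>(i + 1, k\<^sub>i)\<close>.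
  It exists and is unique if \<open>D\<close> is a Dyck path of length \<open>n\<close> and \<open>1 \<le> i \<le> n\<close>.\<close>

definition down_height :: "step list \<Rightarrow> nat \<Rightarrow> nat" where
  "down_height D i = (THE k. \<exists>m < length D. D ! m = Down \<and> vertex D m = (i, k))"

definition dyck_le :: "nat \<Rightarrow> step list \<Rightarrow> step list \<Rightarrow> bool" where
  "dyck_le n D D' \<longleftrightarrow> (\<forall>i \<in> {1..n}. down_height D i \<le> down_height D' i)"

definition points_below :: "nat \<Rightarrow> step list \<Rightarrow> (nat \<times> nat) set" where
  "points_below n D = {(i, j). 1 \<le> i \<and> i \<le> j \<and> j \<le> n \<and> j \<le> down_height D i}"

definition valleys :: "step list \<Rightarrow> (nat \<times> nat) set" where
  "valleys D = {vertex D m | m. 0 < m \<and> m < length D \<and> D ! (m - 1) = Down \<and> D ! m = Up}"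


section \<open>The path algebra of the linearly oriented quiver $1 \leftarrow 2 \leftarrow \cdots \leftarrow n$\<close>

text \<open>A path of this quiver is determined by its end points, so it is encoded as the pair
  (source, target); the trivial path at \<open>i\<close> is \<open>(i, i)\<close> and the arrow \<open>\<alpha>\<^sub>i\<close> is \<open>(i + 1, i)\<close>.
  As in \<open>\<alpha>\<^sub>j \<alpha>\<^sub>j\<^sub>-\<^sub>1 \<dots> \<alpha>\<^sub>i\<close>, a product of paths \<open>p q\<close> means: first \<open>p\<close>, then \<open>q\<close>.\<close>

type_synonym qpath = "nat \<times> nat"

definition qpaths :: "nat \<Rightarrow> qpath set" where
  "qpaths n = {(s, t). 1 \<le> t \<and> t \<le> s \<and> s \<le> n}"

text \<open>An element of the path algebra is given by its coefficients with respect to the basis of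
  paths.\<close>

definition path_algebra :: "nat \<Rightarrow> (qpath \<Rightarrow> complex) ring" where
  "path_algebra n =
    \<lparr>carrier = {x. \<forall>p. p \<notin> qpaths n \<longrightarrow> x p = 0},
     mult = (\<lambda>x y r. \<Sum>(p, q) \<in> {(p, q). p \<in> qpaths n \<and> q \<in> qpaths n \<and>
                                snd p = fst q \<and> (fst p, snd q) = r}. x p * y q),
     one = (\<lambda>p. if p \<in> qpaths n \<and> fst p = snd p then 1 else 0),
     zero = (\<lambda>p. 0),
     add = (\<lambda>x y p. x p + y p)\<rparr>"

definition basis_path :: "qpath \<Rightarrow> qpath \<Rightarrow> complex" where
  "basis_path p = (\<lambda>q. if q = p then 1 else 0)"

definition ideals_without_idempotents :: "nat \<Rightarrow> (qpath \<Rightarrow> complex) set set" where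
  "ideals_without_idempotents n = {I. ideal I (path_algebra n) \<and>
     (\<forall>x \<in> I. x \<otimes>\<^bsub>path_algebra n\<^esub> x = x \<longrightarrow> x = \<zero>\<^bsub>path_algebra n\<^esub>)}"

text \<open>A valley \<open>(a, b)\<close> of a Dyck path of length \<open>n\<close> satisfies \<open>2 \<le> a \<le> b + 1 \<le> n\<close>, so that
  \<open>\<alpha>\<^sub>b \<dots> \<alpha>\<^sub>a\<^sub>-\<^sub>1\<close> is a path, of positive length, from \<open>b + 1\<close> to \<open>a - 1\<close>.\<close>

definition dyck_ideal :: "nat \<Rightarrow> step list \<Rightarrow> (qpath \<Rightarrow> complex) set" where
  "dyck_ideal n D =
     genideal (path_algebra n) {basis_path (b + 1, a - 1) | a b. (a, b) \<in> valleys D}"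


section \<open>Representations\<close>

text \<open>The vector space at vertex \<open>i\<close> is a subspace \<open>sp V i\<close> of an ambient complex vector space
  \<open>'v\<close> with scalar multiplication \<open>s\<close>, and \<open>mp V i\<close> is the linear map
  \<open>sp V (i + 1) \<rightarrow> sp V i\<close> of the arrow \<open>\<alpha>\<^sub>i\<close>.
  Only vertices in \<open>{1..n}\<close> and the values of the maps on these subspaces matter.\<close>

record 'v qrep =
  sp :: "nat \<Rightarrow> 'v set"
  mp :: "nat \<Rightarrow> 'v \<Rightarrow> 'v"

type_synonym 'v scalar_mult = "complex \<Rightarrow> 'v \<Rightarrow> 'v"

definition linear_between ::
  "'v::ab_group_add scalar_mult \<Rightarrow> 'w::ab_group_add scalar_mult \<Rightarrow> 'v set \<Rightarrow> 'w set \<Rightarrow> ('v \<Rightarrow> 'w) \<Rightarrow> bool"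
where
  "linear_between s s' A B f \<longleftrightarrow> f ` A \<subseteq> B \<and>
     (\<forall>x \<in> A. \<forall>y \<in> A. f (x + y) = f x + f y) \<and> (\<forall>c. \<forall>x \<in> A. f (s c x) = s' c (f x))"

definition is_qrep :: "'v::ab_group_add scalar_mult \<Rightarrow> nat \<Rightarrow> 'v qrep \<Rightarrow> bool" where
  "is_qrep s n V \<longleftrightarrow>
     (\<forall>i \<in> {1..n}. \<exists>B. finite B \<and> sp V i = module.span s B) \<and>
     (\<forall>i \<in> {1..<n}. linear_between s s (sp V (i + 1)) (sp V i) (mp V i))"

text \<open>The map \<open>V\<^sub>t\<^sub>+\<^sub>d \<rightarrow> V\<^sub>t\<close> of the path from \<open>t + d\<close> to \<open>t\<close>.\<close>

primrec path_map :: "'v qrep \<Rightarrow> nat \<Rightarrow> nat \<Rightarrow> 'v \<Rightarrow> 'v" where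
  "path_map V t 0 v = v"
| "path_map V t (Suc d) v = path_map V t d (mp V (t + d) v)"

text \<open>The action of an element \<open>x\<close> of the path algebra on the direct sum of the spaces \<open>V\<^sub>i\<close>;
  \<open>v\<close> is a family with \<open>v i \<in> V\<^sub>i\<close>.\<close>

definition qrep_act ::
  "'v::ab_group_add scalar_mult \<Rightarrow> nat \<Rightarrow> 'v qrep \<Rightarrow> (qpath \<Rightarrow> complex) \<Rightarrow> (nat \<Rightarrow> 'v) \<Rightarrow> nat \<Rightarrow> 'v" where
  "qrep_act s n V x v t = (\<Sum>i \<in> {t..n}. s (x (i, t)) (path_map V t (i - t) (v i)))"

text \<open>The (finite-dimensional) modules over the quotient of the path algebra by \<open>I\<close> are the
  representations satisfying the relations in \<open>I\<close>, i.e. those on which \<open>I\<close> acts as zero.\<close>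

definition is_quotient_module ::
  "'v::ab_group_add scalar_mult \<Rightarrow> nat \<Rightarrow> (qpath \<Rightarrow> complex) set \<Rightarrow> 'v qrep \<Rightarrow> bool" where
  "is_quotient_module s n I V \<longleftrightarrow> is_qrep s n V \<and>
     (\<forall>x \<in> I. \<forall>v. (\<forall>i \<in> {1..n}. v i \<in> sp V i) \<longrightarrow> (\<forall>t \<in> {1..n}. qrep_act s n V x v t = 0))"

definition is_subrep ::
  "'v::ab_group_add scalar_mult \<Rightarrow> nat \<Rightarrow> 'v qrep \<Rightarrow> (nat \<Rightarrow> 'v set) \<Rightarrow> bool" where
  "is_subrep s n V U \<longleftrightarrow>
     (\<forall>i \<in> {1..n}. module.subspace s (U i) \<and> U i \<subseteq> sp V i) \<and>
     (\<forall>i \<in> {1..<n}. mp V i ` U (i + 1) \<subseteq> U i)"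

definition zero_spaces :: "nat \<Rightarrow> (nat \<Rightarrow> 'v::ab_group_add set) \<Rightarrow> bool" where
  "zero_spaces n U \<longleftrightarrow> (\<forall>i \<in> {1..n}. U i = {0})"

definition indecomposable ::
  "'v::ab_group_add scalar_mult \<Rightarrow> nat \<Rightarrow> 'v qrep \<Rightarrow> bool" where
  "indecomposable s n V \<longleftrightarrow> \<not> zero_spaces n (sp V) \<and>
     (\<forall>U W. is_subrep s n V U \<and> is_subrep s n V W \<and>
        (\<forall>i \<in> {1..n}. sp V i = {u + w | u w. u \<in> U i \<and> w \<in> W i} \<and> U i \<inter> W i = {0})
        \<longrightarrow> zero_spaces n U \<or> zero_spaces n W)"

definition qrep_iso ::
  "'v::ab_group_add scalar_mult \<Rightarrow> 'w::ab_group_add scalar_mult \<Rightarrow> nat \<Rightarrow> 'v qrep \<Rightarrow> 'w qrep \<Rightarrow> bool" where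
  "qrep_iso s s' n V W \<longleftrightarrow> (\<exists>f.
     (\<forall>i \<in> {1..n}. linear_between s s' (sp V i) (sp W i) (f i) \<and> bij_betw (f i) (sp V i) (sp W i)) \<and>
     (\<forall>i \<in> {1..<n}. \<forall>v \<in> sp V (i + 1). f i (mp V i v) = mp W i (f (i + 1) v)))"

text \<open>The representation \<open>M\<^sub>i\<^sub>,\<^sub>j\<close> for \<open>p = (i, j)\<close>.\<close>

definition interval_rep :: "nat \<times> nat \<Rightarrow> complex qrep" where
  "interval_rep p = (case p of (i, j) \<Rightarrow>
    \<lparr>sp = (\<lambda>k. if i \<le> k \<and> k \<le> j then UNIV else {0}),
     mp = (\<lambda>k. if i \<le> k \<and> k + 1 \<le> j then (\<lambda>z. z) else (\<lambda>z. 0))\<rparr>)"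

end

theory Submission
  imports Defs
begin

text \<open>Both Dyck paths and ideals are governed by an increasing sequence of heights.

  A Dyck path of length \<open>n\<close> is determined by the heights \<open>k\<^sub>t\<close> of its down steps, and every increasing
  sequence with \<open>t \<le> k\<^sub>t \<le> n\<close> occurs (\<open>dyck_path_eqI\<close>, \<open>ex_dyck_path\<close>).  On the other side, the path
  algebra is the algebra of triangular matrices, with the paths as matrix units.  Multiplying by
  matrix units isolates single coefficients, so an ideal is spanned by the paths it contains, and
  with a path it contains every path through it (\<open>ideal_mem_iff_paths\<close>,
  \<open>basis_path_in_ideal_extend\<close>).  Hence the paths into \<open>t\<close> that belong to an ideal are those starting
  beyond some vertex \<open>k\<^sub>t\<close>, and \<open>k\<^sub>t\<close> increases with \<open>t\<close>.  The ideal is without idempotents iff it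
  contains no trivial path, that is \<open>t \<le> k\<^sub>t\<close>, because a strictly triangular idempotent is zero
  (\<open>strictly_triangular_idempotent\<close>).  This gives the same sequences on both sides.  That the
  correspondence is the ideal generated by the valleys holds because a valley is where the heights
  jump, so that the paths given by the valleys are the minimal ones among the paths that start beyond
  \<open>k\<^sub>t\<close> (\<open>dyck_ideal_eq_long_paths\<close>).  Lower heights mean more paths, whence the reversal of the order.

  For the modules, the point is that an indecomposable representation is an interval \<open>M\<^sub>i\<^sub>,\<^sub>j\<close>
  (\<open>indecomposable_is_interval\<close>).  A nonzero path map \<open>V\<^sub>j \<rightarrow> V\<^sub>i\<close> of maximal length provides a copy of
  \<open>M\<^sub>i\<^sub>,\<^sub>j\<close> inside \<open>V\<close>, and maximality allows a linear functional on \<open>V\<^sub>i\<close> to be extended to a retraction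
  of \<open>V\<close> onto it.  The paths acting nontrivially on \<open>M\<^sub>i\<^sub>,\<^sub>j\<close> are the subpaths of the path from \<open>j\<close> to \<open>i\<close>, so
  \<open>M\<^sub>i\<^sub>,\<^sub>j\<close> is a module over the quotient iff this path is not in the ideal, that is \<open>j \<le> k\<^sub>i\<close>.\<close>

section \<open>Dyck paths and their sequences of heights\<close>

text \<open>Carrying the starting height \<open>h\<close> along makes every statement about prefixes of a path a plain
  induction on the path.\<close>

fun down_heights :: "nat \<Rightarrow> step list \<Rightarrow> nat list" where
  "down_heights h [] = []"
| "down_heights h (Up # D) = down_heights (Suc h) D"
| "down_heights h (Down # D) = h # down_heights h D"

lemma step_count_sum: "count_list D Down + count_list D Up = length D"
proof (induction D)
  case (Cons a D)
  then show ?case by (cases a) auto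
qed simp

lemma length_down_heights [simp]: "length (down_heights h D) = count_list D Down"
  by (induction h D rule: down_heights.induct) auto

lemma nth_down_heights:
  "m < length D \<Longrightarrow> D ! m = Down \<Longrightarrow>
    down_heights h D ! count_list (take m D) Down = h + count_list (take m D) Up"
proof (induction h D arbitrary: m rule: down_heights.induct)
  case (2 h D)
  then show ?case by (cases m) auto
next
  case (3 h D)
  then show ?case by (cases m) auto
qed simp

lemma ex_down_step:
  "i < count_list D Down \<Longrightarrow> \<exists>m < length D. D ! m = Down \<and> count_list (take m D) Down = i"
proof (induction D arbitrary: i)
  case (Cons a D)
  show ?case
  proof (cases "a = Down \<and> i = 0")
    case True
    then show ?thesis by (intro exI[of _ 0]) auto
  next
    case False
    then have "(if a = Down then i - 1 else i) < count_list D Down"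
      using Cons.prems by (auto split: if_splits)
    from Cons.IH[OF this] obtain m where
      "m < length D" "D ! m = Down" "count_list (take m D) Down = (if a = Down then i - 1 else i)"
      by blast
    with False show ?thesis by (intro exI[of _ "Suc m"]) auto
  qed
qed simp

lemma down_height_eq_nth:
  assumes "1 \<le> i" "i \<le> count_list D Down"
  shows "down_height D i = down_heights 0 D ! (i - 1)"
proof -
  obtain m where m: "m < length D" "D ! m = Down" "count_list (take m D) Down = i - 1"
    using ex_down_step[of "i - 1" D] assms by fastforce
  show ?thesis
    unfolding down_height_def
  proof (rule the_equality)
    show "\<exists>m<length D. D ! m = Down \<and> vertex D m = (i, down_heights 0 D ! (i - 1))"
      using m nth_down_heights[OF m(1,2), of 0] assms by (auto simp: vertex_def)
  next
    fix k
    assume "\<exists>m<length D. D ! m = Down \<and> vertex D m = (i, k)"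
    then show "k = down_heights 0 D ! (i - 1)"
      using nth_down_heights[of _ D 0] by (fastforce simp: vertex_def)
  qed
qed

lemma down_heights_ge: "k \<in> set (down_heights h D) \<Longrightarrow> h \<le> k"
  by (induction h D rule: down_heights.induct) auto

lemma down_heights_le: "k \<in> set (down_heights h D) \<Longrightarrow> k \<le> h + count_list D Up"
  by (induction h D rule: down_heights.induct) auto

lemma sorted_down_heights: "sorted (down_heights h D)"
  by (induction h D rule: down_heights.induct) (auto dest: down_heights_ge)

text \<open>Two paths first differ where one rises and the other descends.  The second has a down step at
  the current height, whereas all remaining down steps of the first are higher.\<close>

lemma down_heights_inj:
  "down_heights h D = down_heights h D' \<Longrightarrow> count_list D Up = count_list D' Up \<Longrightarrow> D = D'"
proof (induction h D arbitrary: D' rule: down_heights.induct)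
  case (1 h)
  then show ?case by (cases "(h, D')" rule: down_heights.cases) auto
next
  case (2 h D)
  have "D' \<noteq> Down # E" for E
    using 2(2) down_heights_ge[of h "Suc h" D] by auto
  then obtain E where "D' = Up # E"
    using 2(3) by (cases "(h, D')" rule: down_heights.cases) auto
  with 2 show ?case by auto
next
  case (3 h D)
  have "D' \<noteq> Up # E" for E
    using 3(2) down_heights_ge[of h "Suc h" E] by (auto dest: sym)
  then obtain E where "D' = Down # E"
    using 3(2) by (cases "(h, D')" rule: down_heights.cases) auto
  with 3 show ?case by auto
qed

text \<open>The starting height \<open>h\<close> and the final height \<open>n\<close> are parameters, so that the rest of a path
  after a down step is again of this form.\<close>

fun path_with_heights :: "nat \<Rightarrow> nat \<Rightarrow> nat list \<Rightarrow> step list" where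
  "path_with_heights n h [] = replicate (n - h) Up"
| "path_with_heights n h (k # ks) = replicate (k - h) Up @ Down # path_with_heights n k ks"

lemma down_heights_replicate_Up:
  "down_heights h (replicate m Up @ D) = down_heights (h + m) D"
  by (induction m arbitrary: h) auto

lemma count_list_replicate: "count_list (replicate m x) y = (if x = y then m else 0)"
  by (induction m) auto

lemma down_heights_path_with_heights:
  "sorted (h # ks) \<Longrightarrow> down_heights h (path_with_heights n h ks) = ks"
proof (induction ks arbitrary: h)
  case Nil
  show ?case using down_heights_replicate_Up[of h "n - h" "[]"] by simp
qed (simp add: down_heights_replicate_Up)

lemma count_path_with_heights:
  "sorted (h # ks) \<Longrightarrow> \<forall>k \<in> set (h # ks). k \<le> n \<Longrightarrow>
     count_list (path_with_heights n h ks) Up = n - h \<and>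
     count_list (path_with_heights n h ks) Down = length ks"
  by (induction ks arbitrary: h) (auto simp: count_list_replicate)

lemma all_le_Suc: "(\<forall>m \<le> Suc k. P m) \<longleftrightarrow> P 0 \<and> (\<forall>m \<le> k. P (Suc m))"
  using All_less_Suc2[of "Suc k" P] by (simp add: less_Suc_eq_le)

text \<open>A path leaves the region above the diagonal with a down step, so it suffices to look at the
  heights of the down steps; \<open>c\<close> counts the down steps already made.\<close>

lemma above_diagonal_iff:
  "(\<forall>m \<le> length D. c + count_list (take m D) Down \<le> h + count_list (take m D) Up) \<longleftrightarrow>
     c \<le> h \<and> (\<forall>i < count_list D Down. c + i < down_heights h D ! i)"
proof (induction h D arbitrary: c rule: down_heights.induct)
  case (2 h D)
  from "2.IH"[of c] show ?case by (auto simp: all_le_Suc simp del: All_less_Suc2)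
next
  case (3 h D)
  from "3.IH"[of "Suc c"] show ?case by (auto simp: all_le_Suc All_less_Suc2 Suc_le_eq)
qed auto

lemma dyck_paths_iff:
  "D \<in> dyck_paths n \<longleftrightarrow> count_list D Down = n \<and> count_list D Up = n \<and>
     (\<forall>i < n. i < down_heights 0 D ! i)"
  using above_diagonal_iff[of D 0 0] step_count_sum[of D]
  by (auto simp: dyck_paths_def vertex_def)

lemma down_height_nth_dyck:
  "D \<in> dyck_paths n \<Longrightarrow> i < n \<Longrightarrow> down_height D (Suc i) = down_heights 0 D ! i"
  by (simp add: dyck_paths_iff down_height_eq_nth)

lemma down_height_bounds:
  assumes "D \<in> dyck_paths n" "t \<in> {1..n}"
  shows "t \<le> down_height D t" "down_height D t \<le> n"
proof -
  obtain i where i: "t = Suc i" "i < n"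
    using assms(2) by (cases t) auto
  have "down_heights 0 D ! i \<in> set (down_heights 0 D)"
    using assms i by (simp add: dyck_paths_iff)
  then show "t \<le> down_height D t" "down_height D t \<le> n"
    using assms i down_heights_le[of "down_heights 0 D ! i" 0 D]
    by (auto simp: down_height_nth_dyck[OF assms(1)] dyck_paths_iff)
qed

lemma down_height_mono:
  assumes "D \<in> dyck_paths n" "1 \<le> t" "t \<le> u" "u \<le> n"
  shows "down_height D t \<le> down_height D u"
proof -
  have "down_heights 0 D ! (t - 1) \<le> down_heights 0 D ! (u - 1)"
    using assms by (intro sorted_nth_mono sorted_down_heights) (auto simp: dyck_paths_iff)
  then show ?thesis
    using assms down_height_nth_dyck[of D n "t - 1"] down_height_nth_dyck[of D n "u - 1"] by auto
qed

lemma dyck_path_eqI: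
  assumes "D \<in> dyck_paths n" "D' \<in> dyck_paths n"
    and "\<And>t. t \<in> {1..n} \<Longrightarrow> down_height D t = down_height D' t"
  shows "D = D'"
proof (rule down_heights_inj)
  show "count_list D Up = count_list D' Up"
    using assms by (simp add: dyck_paths_iff)
  show "down_heights 0 D = down_heights 0 D'"
  proof (rule nth_equalityI)
    show "length (down_heights 0 D) = length (down_heights 0 D')"
      using assms by (simp add: dyck_paths_iff)
  next
    fix i assume "i < length (down_heights 0 D)"
    then have "i < n" using assms by (simp add: dyck_paths_iff)
    then show "down_heights 0 D ! i = down_heights 0 D' ! i"
      using assms(3)[of "Suc i"] assms(1,2) by (simp add: down_height_nth_dyck)
  qed
qed

text \<open>Thus Dyck paths are the same as increasing sequences of heights that stay between the
  diagonal and \<open>n\<close>; this is the form in which they are compared with ideals.\<close>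

lemma ex_dyck_path:
  assumes bounds: "\<And>t. t \<in> {1..n} \<Longrightarrow> t \<le> k t \<and> k t \<le> n"
    and mono: "\<And>t u. 1 \<le> t \<Longrightarrow> t \<le> u \<Longrightarrow> u \<le> n \<Longrightarrow> k t \<le> k u"
  shows "\<exists>D \<in> dyck_paths n. \<forall>t \<in> {1..n}. down_height D t = k t"
proof -
  define ks where "ks = map (\<lambda>i. k (Suc i)) [0..<n]"
  define D where "D = path_with_heights n 0 ks"
  have "sorted (0 # ks)"
    using mono by (auto simp: ks_def sorted_iff_nth_mono)
  moreover have "\<forall>k \<in> set (0 # ks). k \<le> n"
    using bounds by (auto simp: ks_def)
  ultimately have heights: "down_heights 0 D = ks"
    and counts: "count_list D Up = n" "count_list D Down = n"
    using down_heights_path_with_heights[of 0 ks n] count_path_with_heights[of 0 ks n]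
    by (auto simp: D_def ks_def)
  have D: "D \<in> dyck_paths n"
    using bounds[of "Suc _"] heights counts by (auto simp: dyck_paths_iff ks_def Suc_le_eq)
  moreover have "down_height D t = k t" if "t \<in> {1..n}" for t
    using down_height_nth_dyck[OF D, of "t - 1"] that heights by (auto simp: ks_def)
  ultimately show ?thesis by blast
qed

lemma valley_height:
  assumes "D \<in> dyck_paths n" "(a, b) \<in> valleys D"
  shows "2 \<le> a" "a - 1 \<le> n" "down_height D (a - 1) = b" "b < n"
proof -
  obtain m where m: "0 < m" "m < length D" "D ! (m - 1) = Down" "D ! m = Up"
    and ab: "(a, b) = vertex D m"
    using assms(2) by (auto simp: valleys_def)
  obtain l where l: "m = Suc l" using m(1) by (cases m) auto
  have downs: "count_list (take m D) Down = Suc (count_list (take l D) Down)"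
    and ups: "count_list (take m D) Up = count_list (take l D) Up"
    using m l by (auto simp: take_Suc_conv_app_nth)
  have split: "count_list D x = count_list (take m D) x + count_list (D ! m # drop (Suc m) D) x" for x
    using m(2) by (metis Cons_nth_drop_Suc append_take_drop_id count_list_append)
  from split[of Down] show "a - 1 \<le> n"
    using assms(1) ab m by (simp add: dyck_paths_iff vertex_def)
  from split[of Up] show "b < n"
    using assms(1) ab m by (simp add: dyck_paths_iff vertex_def)
  show "2 \<le> a" using ab downs by (simp add: vertex_def)
  have "down_heights 0 D ! count_list (take l D) Down = b"
    using nth_down_heights[of l D 0] m l ab ups by (simp add: vertex_def)
  then show "down_height D (a - 1) = b"
    using assms(1) ab downs \<open>a - 1 \<le> n\<close> down_height_nth_dyck[of D n "a - 2"]
    by (simp add: vertex_def)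
qed

text \<open>If a down step lies below height \<open>n\<close>, the path still has to rise after it; it does so
  for the first time at a valley of the same height.\<close>

lemma ex_valley:
  assumes "D \<in> dyck_paths n" "t \<in> {1..n}" "down_height D t < n"
  shows "\<exists>a. t < a \<and> (a, down_height D t) \<in> valleys D"
proof -
  obtain m where m: "m < length D" "D ! m = Down" "count_list (take m D) Down = t - 1"
    using ex_down_step[of "t - 1" D] assms by (fastforce simp: dyck_paths_iff)
  define xs ys where "xs = take m D" and "ys = drop (Suc m) D"
  have D: "D = xs @ Down # ys"
    using m by (metis xs_def ys_def id_take_nth_drop)
  have height: "down_height D t = count_list xs Up"
    using nth_down_heights[OF m(1,2), of 0] m(3) assms(1,2) down_height_nth_dyck[of D n "t - 1"]
    by (auto simp: xs_def)
  have "count_list ys Up \<noteq> 0"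
    using assms(1,3) height D by (auto simp: dyck_paths_iff)
  then have "Up \<in> set ys" by (metis count_notin)
  then obtain us vs where ys: "ys = us @ Up # vs" and us: "Up \<notin> set us"
    by (meson split_list_first)
  define l where "l = length (xs @ Down # us)"
  have D': "D = (xs @ Down # us) @ Up # vs" using D ys by simp
  have "D ! (l - 1) = last (Down # us)"
    using D by (simp add: l_def ys nth_append last_conv_nth)
  also have "\<dots> \<noteq> Up"
    using us last_in_set[of "Down # us"] by auto
  finally have "D ! (l - 1) = Down" by (cases "D ! (l - 1)") auto
  moreover have "D ! l = Up" "l < length D" "0 < l"
    using D' by (auto simp: l_def nth_append)
  ultimately have "vertex D l \<in> valleys D" by (auto simp: valleys_def)
  moreover have "take l D = xs @ Down # us" unfolding D' l_def by simp
  then have "vertex D l = (t + 1 + count_list us Down, down_height D t)"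
    using m(3) us height assms(2) by (simp add: vertex_def xs_def)
  ultimately show ?thesis by (intro exI[of _ "t + 1 + count_list us Down"]) simp
qed

section \<open>The path algebra and its ideals\<close>

lemma carrier_path_algebra:
  "x \<in> carrier (path_algebra n) \<longleftrightarrow> (\<forall>p. p \<notin> qpaths n \<longrightarrow> x p = 0)"
  by (simp add: path_algebra_def)

lemma add_path_algebra: "x \<oplus>\<^bsub>path_algebra n\<^esub> y = (\<lambda>p. x p + y p)"
  by (simp add: path_algebra_def)

lemma zero_path_algebra: "\<zero>\<^bsub>path_algebra n\<^esub> = (\<lambda>p. 0)"
  by (simp add: path_algebra_def)

lemma one_path_algebra:
  "\<one>\<^bsub>path_algebra n\<^esub> = (\<lambda>p. if p \<in> qpaths n \<and> fst p = snd p then 1 else 0)"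
  by (simp add: path_algebra_def)

text \<open>Paths multiply like matrix units, so on coefficients the product is the product of
  triangular matrices.\<close>

lemma mult_path_algebra:
  assumes "x \<in> carrier (path_algebra n)" "y \<in> carrier (path_algebra n)"
  shows "(x \<otimes>\<^bsub>path_algebra n\<^esub> y) (s, t) = (\<Sum>u\<in>{1..n}. x (s, u) * y (u, t))"
proof -
  let ?U = "{u \<in> {1..n}. (s, u) \<in> qpaths n \<and> (u, t) \<in> qpaths n}"
  have pairs: "{(p, q). p \<in> qpaths n \<and> q \<in> qpaths n \<and> snd p = fst q \<and> (fst p, snd q) = (s, t)}
      = (\<lambda>u. ((s, u), (u, t))) ` ?U"
    by (auto simp: qpaths_def)
  have "(x \<otimes>\<^bsub>path_algebra n\<^esub> y) (s, t)
      = (\<Sum>(p, q) \<in> (\<lambda>u. ((s, u), (u, t))) ` ?U. x p * y q)"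
    unfolding pairs[symmetric] by (simp add: path_algebra_def)
  also have "\<dots> = (\<Sum>u\<in>?U. x (s, u) * y (u, t))"
    by (subst sum.reindex) (auto simp: inj_on_def)
  also have "\<dots> = (\<Sum>u\<in>{1..n}. x (s, u) * y (u, t))"
    using assms by (intro sum.mono_neutral_left) (auto simp: carrier_path_algebra)
  finally show ?thesis .
qed

lemma mult_closed_path_algebra:
  assumes "x \<in> carrier (path_algebra n)" "y \<in> carrier (path_algebra n)"
  shows "x \<otimes>\<^bsub>path_algebra n\<^esub> y \<in> carrier (path_algebra n)"
proof -
  have "(x \<otimes>\<^bsub>path_algebra n\<^esub> y) (s, t) = 0" if "(s, t) \<notin> qpaths n" for s t
  proof -
    have "\<forall>u. x (s, u) * y (u, t) = 0"
    proof
      fix u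
      have "(s, u) \<notin> qpaths n \<or> (u, t) \<notin> qpaths n" using that by (auto simp: qpaths_def)
      then show "x (s, u) * y (u, t) = 0" using assms by (auto simp: carrier_path_algebra)
    qed
    then show ?thesis unfolding mult_path_algebra[OF assms] by (intro sum.neutral) blast
  qed
  then show ?thesis by (auto simp: carrier_path_algebra)
qed

lemma add_closed_path_algebra:
  "x \<in> carrier (path_algebra n) \<Longrightarrow> y \<in> carrier (path_algebra n) \<Longrightarrow>
     x \<oplus>\<^bsub>path_algebra n\<^esub> y \<in> carrier (path_algebra n)"
  by (simp add: carrier_path_algebra add_path_algebra)

lemma one_closed_path_algebra: "\<one>\<^bsub>path_algebra n\<^esub> \<in> carrier (path_algebra n)"
  by (simp add: carrier_path_algebra one_path_algebra)

lemma one_mult_path_algebra: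
  assumes x: "x \<in> carrier (path_algebra n)"
  shows "\<one>\<^bsub>path_algebra n\<^esub> \<otimes>\<^bsub>path_algebra n\<^esub> x = x"
    and "x \<otimes>\<^bsub>path_algebra n\<^esub> \<one>\<^bsub>path_algebra n\<^esub> = x"
proof -
  have "(\<one>\<^bsub>path_algebra n\<^esub> \<otimes>\<^bsub>path_algebra n\<^esub> x) (s, t) = x (s, t)" for s t
  proof -
    have "(\<one>\<^bsub>path_algebra n\<^esub> \<otimes>\<^bsub>path_algebra n\<^esub> x) (s, t)
        = (\<Sum>u\<in>{1..n}. if u = s then x (u, t) else 0)"
      unfolding mult_path_algebra[OF one_closed_path_algebra x]
      by (intro sum.cong) (auto simp: one_path_algebra qpaths_def)
    then show ?thesis using x by (auto simp: carrier_path_algebra qpaths_def)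
  qed
  then show "\<one>\<^bsub>path_algebra n\<^esub> \<otimes>\<^bsub>path_algebra n\<^esub> x = x" by auto
  have "(x \<otimes>\<^bsub>path_algebra n\<^esub> \<one>\<^bsub>path_algebra n\<^esub>) (s, t) = x (s, t)" for s t
  proof -
    have "(x \<otimes>\<^bsub>path_algebra n\<^esub> \<one>\<^bsub>path_algebra n\<^esub>) (s, t)
        = (\<Sum>u\<in>{1..n}. if u = t then x (s, u) else 0)"
      unfolding mult_path_algebra[OF x one_closed_path_algebra]
      by (intro sum.cong) (auto simp: one_path_algebra qpaths_def)
    then show ?thesis using x by (auto simp: carrier_path_algebra qpaths_def)
  qed
  then show "x \<otimes>\<^bsub>path_algebra n\<^esub> \<one>\<^bsub>path_algebra n\<^esub> = x" by auto
qed

lemma mult_assoc_path_algebra: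
  assumes "x \<in> carrier (path_algebra n)" "y \<in> carrier (path_algebra n)"
    "z \<in> carrier (path_algebra n)"
  shows "(x \<otimes>\<^bsub>path_algebra n\<^esub> y) \<otimes>\<^bsub>path_algebra n\<^esub> z
    = x \<otimes>\<^bsub>path_algebra n\<^esub> (y \<otimes>\<^bsub>path_algebra n\<^esub> z)"
proof -
  have "((x \<otimes>\<^bsub>path_algebra n\<^esub> y) \<otimes>\<^bsub>path_algebra n\<^esub> z) (s, t)
      = (x \<otimes>\<^bsub>path_algebra n\<^esub> (y \<otimes>\<^bsub>path_algebra n\<^esub> z)) (s, t)" for s t
  proof -
    have "((x \<otimes>\<^bsub>path_algebra n\<^esub> y) \<otimes>\<^bsub>path_algebra n\<^esub> z) (s, t)
        = (\<Sum>w\<in>{1..n}. \<Sum>u\<in>{1..n}. x (s, u) * y (u, w) * z (w, t))"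
      using assms by (simp add: mult_path_algebra mult_closed_path_algebra sum_distrib_right)
    also have "\<dots> = (\<Sum>u\<in>{1..n}. \<Sum>w\<in>{1..n}. x (s, u) * y (u, w) * z (w, t))"
      by (rule sum.swap)
    also have "\<dots> = (x \<otimes>\<^bsub>path_algebra n\<^esub> (y \<otimes>\<^bsub>path_algebra n\<^esub> z)) (s, t)"
      using assms
      by (simp add: mult_path_algebra mult_closed_path_algebra sum_distrib_left mult.assoc)
    finally show ?thesis .
  qed
  then show ?thesis by auto
qed

lemma ring_path_algebra: "ring (path_algebra n)"
proof (rule ringI)
  show "abelian_group (path_algebra n)"
  proof (rule abelian_groupI)
    fix x assume "x \<in> carrier (path_algebra n)"
    then show "\<exists>y\<in>carrier (path_algebra n). y \<oplus>\<^bsub>path_algebra n\<^esub> x = \<zero>\<^bsub>path_algebra n\<^esub>"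
      by (intro bexI[of _ "\<lambda>p. - x p"])
        (auto simp: carrier_path_algebra add_path_algebra zero_path_algebra)
  qed (auto simp: carrier_path_algebra add_path_algebra zero_path_algebra add_ac)
  show "Group.monoid (path_algebra n)"
    by (intro monoidI) (simp_all add: mult_closed_path_algebra one_closed_path_algebra
        one_mult_path_algebra mult_assoc_path_algebra)
next
  fix x y z assume xyz: "x \<in> carrier (path_algebra n)" "y \<in> carrier (path_algebra n)"
    "z \<in> carrier (path_algebra n)"
  have "((x \<oplus>\<^bsub>path_algebra n\<^esub> y) \<otimes>\<^bsub>path_algebra n\<^esub> z) (s, t)
      = (x \<otimes>\<^bsub>path_algebra n\<^esub> z \<oplus>\<^bsub>path_algebra n\<^esub> y \<otimes>\<^bsub>path_algebra n\<^esub> z) (s, t)" for s t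
    using xyz by (simp add: mult_path_algebra add_closed_path_algebra)
      (simp add: mult_path_algebra add_path_algebra sum.distrib distrib_right)
  then show "(x \<oplus>\<^bsub>path_algebra n\<^esub> y) \<otimes>\<^bsub>path_algebra n\<^esub> z
      = x \<otimes>\<^bsub>path_algebra n\<^esub> z \<oplus>\<^bsub>path_algebra n\<^esub> y \<otimes>\<^bsub>path_algebra n\<^esub> z" by auto
  have "(z \<otimes>\<^bsub>path_algebra n\<^esub> (x \<oplus>\<^bsub>path_algebra n\<^esub> y)) (s, t)
      = (z \<otimes>\<^bsub>path_algebra n\<^esub> x \<oplus>\<^bsub>path_algebra n\<^esub> z \<otimes>\<^bsub>path_algebra n\<^esub> y) (s, t)" for s t
    using xyz by (simp add: mult_path_algebra add_closed_path_algebra)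
      (simp add: mult_path_algebra add_path_algebra sum.distrib distrib_left)
  then show "z \<otimes>\<^bsub>path_algebra n\<^esub> (x \<oplus>\<^bsub>path_algebra n\<^esub> y)
      = z \<otimes>\<^bsub>path_algebra n\<^esub> x \<oplus>\<^bsub>path_algebra n\<^esub> z \<otimes>\<^bsub>path_algebra n\<^esub> y" by auto
qed

definition scaled_path :: "complex \<Rightarrow> qpath \<Rightarrow> qpath \<Rightarrow> complex" where
  "scaled_path c p = (\<lambda>q. if q = p then c else 0)"

lemma basis_path_eq_scaled: "basis_path p = scaled_path 1 p"
  by (simp add: basis_path_def scaled_path_def)

lemma scaled_path_closed: "p \<in> qpaths n \<Longrightarrow> scaled_path c p \<in> carrier (path_algebra n)"
  by (auto simp: carrier_path_algebra scaled_path_def)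

lemma scaled_path_mult:
  assumes "(s, u) \<in> qpaths n" "x \<in> carrier (path_algebra n)"
  shows "scaled_path c (s, u) \<otimes>\<^bsub>path_algebra n\<^esub> x = (\<lambda>(s', t). if s' = s then c * x (u, t) else 0)"
proof -
  have "(scaled_path c (s, u) \<otimes>\<^bsub>path_algebra n\<^esub> x) (s', t)
      = (\<Sum>w\<in>{1..n}. if w = u then (if s' = s then c * x (u, t) else 0) else 0)" for s' t
    unfolding mult_path_algebra[OF scaled_path_closed[OF assms(1)] assms(2)]
    by (intro sum.cong) (auto simp: scaled_path_def)
  moreover have "u \<in> {1..n}" using assms(1) by (auto simp: qpaths_def)
  ultimately show ?thesis by auto
qed

lemma mult_scaled_path:
  assumes "(u, t) \<in> qpaths n" "x \<in> carrier (path_algebra n)"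
  shows "x \<otimes>\<^bsub>path_algebra n\<^esub> scaled_path c (u, t) = (\<lambda>(s, t'). if t' = t then c * x (s, u) else 0)"
proof -
  have "(x \<otimes>\<^bsub>path_algebra n\<^esub> scaled_path c (u, t)) (s, t')
      = (\<Sum>w\<in>{1..n}. if w = u then (if t' = t then c * x (s, u) else 0) else 0)" for s t'
    unfolding mult_path_algebra[OF assms(2) scaled_path_closed[OF assms(1)]]
    by (intro sum.cong) (auto simp: scaled_path_def)
  moreover have "u \<in> {1..n}" using assms(1) by (auto simp: qpaths_def)
  ultimately show ?thesis by auto
qed

text \<open>Multiplying \<open>x\<close> on both sides by paths moves any one of its coefficients to a longer path
  and erases all the others.  Thus an ideal contains every path that occurs in one of its
  elements, and with a path all the paths through it.\<close>

lemma ideal_contains_scaled_path: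
  assumes I: "ideal I (path_algebra n)" and x: "x \<in> I" "x (s, t) \<noteq> 0"
    and "s \<le> s'" "s' \<le> n" "1 \<le> t'" "t' \<le> t"
  shows "scaled_path c (s', t') \<in> I"
proof -
  interpret ideal I "path_algebra n" by fact
  have xc: "x \<in> carrier (path_algebra n)" using x(1) by (rule Icarr)
  have st: "(s, t) \<in> qpaths n" using xc x(2) by (auto simp: carrier_path_algebra)
  have q: "(s', s) \<in> qpaths n" "(t, t') \<in> qpaths n" using st assms by (auto simp: qpaths_def)
  let ?l = "scaled_path (c / x (s, t)) (s', s)" and ?r = "scaled_path 1 (t, t')"
  have "?l \<otimes>\<^bsub>path_algebra n\<^esub> x \<otimes>\<^bsub>path_algebra n\<^esub> ?r \<in> I"
    using x q by (intro I_l_closed I_r_closed scaled_path_closed)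
  moreover have "?l \<otimes>\<^bsub>path_algebra n\<^esub> x \<otimes>\<^bsub>path_algebra n\<^esub> ?r = scaled_path c (s', t')"
    unfolding mult_scaled_path[OF q(2) mult_closed_path_algebra[OF scaled_path_closed[OF q(1)] xc]]
    unfolding scaled_path_mult[OF q(1) xc]
    using x(2) by (auto simp: scaled_path_def fun_eq_iff)
  ultimately show ?thesis by simp
qed

lemma finite_qpaths: "finite (qpaths n)"
  by (rule finite_subset[of _ "{..n} \<times> {..n}"]) (auto simp: qpaths_def)

lemma mem_ideal_if_scaled_paths:
  assumes I: "ideal I (path_algebra n)" and x: "x \<in> carrier (path_algebra n)"
    and paths: "\<And>p. x p \<noteq> 0 \<Longrightarrow> scaled_path (x p) p \<in> I"
  shows "x \<in> I"
proof -
  interpret ideal I "path_algebra n" by fact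
  have zero: "(\<lambda>p. 0) \<in> I"
    using additive_subgroup.zero_closed[OF is_additive_subgroup] by (simp add: zero_path_algebra)
  have "(\<lambda>p. if p \<in> S then x p else 0) \<in> I" if "finite S" for S
    using that
  proof (induction S rule: finite_induct)
    case empty
    show ?case using zero by simp
  next
    case (insert p S)
    have "scaled_path (x p) p \<in> I"
    proof (cases "x p = 0")
      case True
      then show ?thesis using zero by (simp add: scaled_path_def)
    qed (rule paths)
    from additive_subgroup.a_closed[OF is_additive_subgroup this insert.IH]
    have "(\<lambda>q. scaled_path (x p) p q + (if q \<in> S then x q else 0)) \<in> I"
      by (simp add: add_path_algebra)
    moreover have "(\<lambda>q. scaled_path (x p) p q + (if q \<in> S then x q else 0))
        = (\<lambda>q. if q \<in> insert p S then x q else 0)"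
      using insert.hyps by (auto simp: scaled_path_def)
    ultimately show ?case by simp
  qed
  from this[OF finite_qpaths[of n]] have "(\<lambda>p. if p \<in> qpaths n then x p else 0) \<in> I" .
  moreover have "(\<lambda>p. if p \<in> qpaths n then x p else 0) = x"
    using x by (auto simp: carrier_path_algebra)
  ultimately show ?thesis by simp
qed

text \<open>Consequently an ideal is determined by the paths that it contains.\<close>

lemma ideal_mem_iff_paths:
  assumes I: "ideal I (path_algebra n)"
  shows "x \<in> I \<longleftrightarrow> x \<in> carrier (path_algebra n) \<and> (\<forall>p. x p \<noteq> 0 \<longrightarrow> basis_path p \<in> I)"
proof (intro iffI conjI allI impI)
  assume "x \<in> I"
  then show xc: "x \<in> carrier (path_algebra n)" by (rule ideal.Icarr[OF I])
  fix p assume "x p \<noteq> 0"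
  moreover from this have "p \<in> qpaths n" using xc unfolding carrier_path_algebra by metis
  ultimately show "basis_path p \<in> I"
    using ideal_contains_scaled_path[OF I \<open>x \<in> I\<close>, of "fst p" "snd p" "fst p" "snd p" 1]
    by (auto simp: basis_path_eq_scaled qpaths_def)
next
  assume x: "x \<in> carrier (path_algebra n) \<and> (\<forall>p. x p \<noteq> 0 \<longrightarrow> basis_path p \<in> I)"
  show "x \<in> I"
  proof (rule mem_ideal_if_scaled_paths[OF I])
    fix p assume p: "x p \<noteq> 0"
    then have "p \<in> qpaths n" using x unfolding carrier_path_algebra by metis
    with p x show "scaled_path (x p) p \<in> I"
      using ideal_contains_scaled_path[OF I, of "basis_path p" "fst p" "snd p" "fst p" "snd p" "x p"]
      by (auto simp: basis_path_def qpaths_def)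
  qed (use x in simp)
qed

lemma basis_path_in_ideal_extend:
  assumes "ideal I (path_algebra n)" "basis_path (s, t) \<in> I" "s \<le> s'" "s' \<le> n" "1 \<le> t'" "t' \<le> t"
  shows "basis_path (s', t') \<in> I"
  using ideal_contains_scaled_path[OF assms(1,2) _ assms(3-6), of 1]
  by (simp add: basis_path_eq_scaled) (simp add: scaled_path_def)

text \<open>For the heights \<open>k\<close> of a Dyck path this is its ideal, in a form in which membership can be
  tested coefficient by coefficient.\<close>

definition long_paths :: "nat \<Rightarrow> (nat \<Rightarrow> nat) \<Rightarrow> (qpath \<Rightarrow> complex) set" where
  "long_paths n k = {x \<in> carrier (path_algebra n). \<forall>s t. x (s, t) \<noteq> 0 \<longrightarrow> k t < s}"

lemma basis_path_in_long_paths: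
  "basis_path (s, t) \<in> long_paths n k \<longleftrightarrow> (s, t) \<in> qpaths n \<and> k t < s"
  by (auto simp: long_paths_def carrier_path_algebra basis_path_def)

text \<open>Multiplying by a path on the left moves the source of a path up, which keeps it beyond
  \<open>k t\<close>.  Multiplying on the right moves the target down from \<open>u\<close> to \<open>t\<close>, which is harmless because
  \<open>k\<close> is increasing.\<close>

lemma ideal_long_paths:
  assumes mono: "\<And>t u. 1 \<le> t \<Longrightarrow> t \<le> u \<Longrightarrow> u \<le> n \<Longrightarrow> k t \<le> k u"
  shows "ideal (long_paths n k) (path_algebra n)"
proof (rule idealI[OF ring_path_algebra])
  interpret ring "path_algebra n" by (rule ring_path_algebra)
  show "subgroup (long_paths n k) (add_monoid (path_algebra n))"
  proof (rule add.subgroupI)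
    fix x assume x: "x \<in> long_paths n k"
    then have xc: "x \<in> carrier (path_algebra n)" by (simp add: long_paths_def)
    then have "\<ominus>\<^bsub>path_algebra n\<^esub> x = (\<lambda>p. - x p)"
      by (intro minus_equality)
        (auto simp: carrier_path_algebra add_path_algebra zero_path_algebra)
    then show "\<ominus>\<^bsub>path_algebra n\<^esub> x \<in> long_paths n k"
      using x by (auto simp: long_paths_def carrier_path_algebra)
  next
    fix x y assume xy: "x \<in> long_paths n k" "y \<in> long_paths n k"
    have "k t < s" if "x (s, t) + y (s, t) \<noteq> 0" for s t
    proof -
      have "x (s, t) \<noteq> 0 \<or> y (s, t) \<noteq> 0" using that by auto
      then show ?thesis using xy by (auto simp: long_paths_def)
    qed
    then show "x \<oplus>\<^bsub>path_algebra n\<^esub> y \<in> long_paths n k"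
      using xy add_closed_path_algebra[of x n y] by (auto simp: long_paths_def add_path_algebra)
  next
    have "\<zero>\<^bsub>path_algebra n\<^esub> \<in> long_paths n k"
      by (simp add: long_paths_def carrier_path_algebra zero_path_algebra)
    then show "long_paths n k \<noteq> {}" by blast
  qed (auto simp: long_paths_def)
next
  fix a x assume a: "a \<in> long_paths n k" and x: "x \<in> carrier (path_algebra n)"
  then have ac: "a \<in> carrier (path_algebra n)" by (simp add: long_paths_def)
  have "k t < s" if "(x \<otimes>\<^bsub>path_algebra n\<^esub> a) (s, t) \<noteq> 0" for s t
  proof -
    obtain u where "x (s, u) * a (u, t) \<noteq> 0"
      using \<open>_ \<noteq> 0\<close> unfolding mult_path_algebra[OF x ac] by (meson sum.neutral)
    then have "k t < u" "u \<le> s"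
      using a x by (auto simp: long_paths_def carrier_path_algebra qpaths_def)
    then show ?thesis by simp
  qed
  then show "x \<otimes>\<^bsub>path_algebra n\<^esub> a \<in> long_paths n k"
    using mult_closed_path_algebra[OF x ac] by (auto simp: long_paths_def)
  have "k t < s" if "(a \<otimes>\<^bsub>path_algebra n\<^esub> x) (s, t) \<noteq> 0" for s t
  proof -
    obtain u where "a (s, u) * x (u, t) \<noteq> 0"
      using \<open>_ \<noteq> 0\<close> unfolding mult_path_algebra[OF ac x] by (meson sum.neutral)
    then have "k u < s" "(u, t) \<in> qpaths n"
      using a x by (auto simp: long_paths_def carrier_path_algebra)
    then show ?thesis using mono[of t u] by (auto simp: qpaths_def)
  qed
  then show "a \<otimes>\<^bsub>path_algebra n\<^esub> x \<in> long_paths n k"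
    using mult_closed_path_algebra[OF ac x] by (auto simp: long_paths_def)
qed

text \<open>An element without trivial paths is strictly triangular.  If it equals its own square,
  each coefficient is a sum of products of coefficients of shorter paths, so all of them vanish.\<close>

lemma strictly_triangular_idempotent:
  assumes x: "x \<in> carrier (path_algebra n)" and idem: "x \<otimes>\<^bsub>path_algebra n\<^esub> x = x"
    and strict: "\<And>t. x (t, t) = 0"
  shows "x = \<zero>\<^bsub>path_algebra n\<^esub>"
proof -
  have tri: "t < s" if "x (s, t) \<noteq> 0" for s t
  proof -
    have "(s, t) \<in> qpaths n" using x that unfolding carrier_path_algebra by metis
    moreover have "s \<noteq> t" using that strict by auto
    ultimately show ?thesis by (simp add: qpaths_def)
  qed
  have "x (s, t) = 0" for s t
  proof (induction "s - t" arbitrary: s t rule: less_induct)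
    case less
    have "x (s, u) * x (u, t) = 0" for u
      using tri[of s u] tri[of u t] less[of u t] by force
    then have "(x \<otimes>\<^bsub>path_algebra n\<^esub> x) (s, t) = 0"
      unfolding mult_path_algebra[OF x x] by (intro sum.neutral) blast
    then show ?case by (simp add: idem)
  qed
  then show ?thesis by (auto simp: zero_path_algebra)
qed

lemma trivial_path_notin:
  assumes "I \<in> ideals_without_idempotents n" "t \<in> {1..n}"
  shows "basis_path (t, t) \<notin> I"
proof
  assume mem: "basis_path (t, t) \<in> I"
  have q: "(t, t) \<in> qpaths n" using assms(2) by (auto simp: qpaths_def)
  have "basis_path (t, t) \<otimes>\<^bsub>path_algebra n\<^esub> basis_path (t, t) = basis_path (t, t)"
    by (auto simp: basis_path_eq_scaled scaled_path_mult[OF q scaled_path_closed[OF q]])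
      (auto simp: scaled_path_def)
  then have "basis_path (t, t) = \<zero>\<^bsub>path_algebra n\<^esub>"
    using assms(1) mem by (simp add: ideals_without_idempotents_def)
  then have "basis_path (t, t) (t, t) = 0" by (simp add: zero_path_algebra)
  then show False by (simp add: basis_path_def)
qed

section \<open>Indecomposable representations\<close>

lemma path_map_add: "path_map V t (d + e) v = path_map V t d (path_map V (t + d) e v)"
  by (induction e arbitrary: v) (simp_all add: add.assoc)

lemma mp_path_map: "mp V t (path_map V (Suc t) d v) = path_map V t (Suc d) v"
  using path_map_add[of V t 1 d v] by simp

locale complex_vector_space = vector_space scale
  for scale :: "complex \<Rightarrow> 'v::ab_group_add \<Rightarrow> 'v"
begin

lemma subspace_qrep: "is_qrep scale n V \<Longrightarrow> i \<in> {1..n} \<Longrightarrow> subspace (sp V i)"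
  unfolding is_qrep_def by (metis subspace_span)

lemma mp_homogeneous:
  assumes "is_qrep scale n V" "1 \<le> i" "i < n"
  shows "x \<in> sp V (Suc i) \<Longrightarrow> mp V i x \<in> sp V i"
    and "x \<in> sp V (Suc i) \<Longrightarrow> mp V i (scale c x) = scale c (mp V i x)"
proof -
  have "linear_between scale scale (sp V (Suc i)) (sp V i) (mp V i)"
    using assms by (simp add: is_qrep_def)
  then show "x \<in> sp V (Suc i) \<Longrightarrow> mp V i x \<in> sp V i"
    and "x \<in> sp V (Suc i) \<Longrightarrow> mp V i (scale c x) = scale c (mp V i x)"
    by (auto simp: linear_between_def)
qed

lemma path_map_linear:
  assumes V: "is_qrep scale n V"
  shows "1 \<le> t \<Longrightarrow> t + d \<le> n \<Longrightarrow> linear_between scale scale (sp V (t + d)) (sp V t) (path_map V t d)"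
proof (induction d)
  case 0
  show ?case by (auto simp: linear_between_def)
next
  case (Suc d)
  have "linear_between scale scale (sp V (Suc (t + d))) (sp V (t + d)) (mp V (t + d))"
    using V Suc.prems by (simp add: is_qrep_def)
  with Suc show ?case by (auto simp: linear_between_def image_subset_iff)
qed

end

text \<open>Take a nonzero path map \<open>V\<^sub>j \<rightarrow> V\<^sub>i\<close> of maximal length and a vector \<open>v\<close> of \<open>V\<^sub>j\<close> with nonzero
  image in \<open>V\<^sub>i\<close>.  The images of \<open>v\<close> span a copy of \<open>M\<^sub>i\<^sub>,\<^sub>j\<close> in \<open>V\<close>, as by maximality the image in
  \<open>V\<^sub>i\<^sub>-\<^sub>1\<close> is zero.  A linear functional \<open>\<phi>\<close> on \<open>V\<^sub>i\<close> with value \<open>1\<close> on the image of \<open>v\<close>, composed with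
  the path maps into \<open>V\<^sub>i\<close>, gives a morphism \<open>f: V \<rightarrow> M\<^sub>i\<^sub>,\<^sub>j\<close>: at the arrow from \<open>j + 1\<close> to \<open>j\<close> it is
  compatible since the path map \<open>V\<^sub>j\<^sub>+\<^sub>1 \<rightarrow> V\<^sub>i\<close> vanishes, again by maximality.  As \<open>f\<close> maps the copy
  of \<open>M\<^sub>i\<^sub>,\<^sub>j\<close> isomorphically, the kernel of \<open>f\<close> is a complement of it, and it is zero if \<open>V\<close> is
  indecomposable.

  The nonzero path map in the conclusion is what a relation of a quotient algebra has to annihilate
  in order to exclude the point \<open>(i, j)\<close>.\<close>

lemma indecomposable_is_interval:
  fixes s :: "complex \<Rightarrow> 'v::ab_group_add \<Rightarrow> 'v"
  assumes "vector_space s" and V: "is_qrep s n V" and indec: "indecomposable s n V"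
  shows "\<exists>i j. 1 \<le> i \<and> i \<le> j \<and> j \<le> n \<and> (\<exists>v \<in> sp V j. path_map V i (j - i) v \<noteq> 0) \<and>
    qrep_iso s (*) n V (interval_rep (i, j))"
proof -
  interpret complex_vector_space s
    using assms(1) by (simp add: complex_vector_space_def)
  interpret functional: vector_space_pair s "(*) :: complex \<Rightarrow> complex \<Rightarrow> complex"
    by unfold_locales (auto simp: algebra_simps)
  have zero_in: "0 \<in> sp V k" if "k \<in> {1..n}" for k
    using subspace_qrep[OF V that] by (rule subspace_0)
  define L where
    "L = {d. \<exists>i v. 1 \<le> i \<and> i + d \<le> n \<and> v \<in> sp V (i + d) \<and> path_map V i d v \<noteq> 0}"
  obtain i0 v0 where "i0 \<in> {1..n}" "v0 \<in> sp V i0" "v0 \<noteq> 0"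
    using indec zero_in by (force simp: indecomposable_def zero_spaces_def)
  then have "0 \<in> L" by (auto simp: L_def)
  have "L \<subseteq> {..n}" by (auto simp: L_def)
  then have "finite L" by (rule finite_subset) simp
  define d where "d = Max L"
  have "d \<in> L" using \<open>0 \<in> L\<close> \<open>finite L\<close> unfolding d_def by (intro Max_in) auto
  have "Suc d \<notin> L" using \<open>finite L\<close> Max_ge[of L "Suc d"] unfolding d_def by linarith
  then have longer: "path_map V i (Suc d) x = 0"
    if "1 \<le> i" "i + Suc d \<le> n" "x \<in> sp V (i + Suc d)" for i x
    using that unfolding L_def by blast
  from \<open>d \<in> L\<close> obtain i v where i: "1 \<le> i" "i + d \<le> n"
    and v: "v \<in> sp V (i + d)" "path_map V i d v \<noteq> 0"
    by (auto simp: L_def)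
  define j where "j = i + d"
  have ij: "i \<le> j" "j \<le> n" "j - i = d" using i by (auto simp: j_def)
  have lin: "linear_between s s (sp V j) (sp V k) (path_map V k (j - k))" if "1 \<le> k" "k \<le> j" for k
    using path_map_linear[OF V that(1), of "j - k"] that ij by simp
  have lin_i: "linear_between s s (sp V k) (sp V i) (path_map V i (k - i))" if "i \<le> k" "k \<le> n" for k
    using path_map_linear[OF V i(1), of "k - i"] that by simp
  define vec where "vec k = path_map V k (j - k) v" for k
  have vec_in: "vec k \<in> sp V k" if "1 \<le> k" "k \<le> j" for k
    using lin[OF that] v(1) by (auto simp: vec_def linear_between_def j_def)
  have "\<not> dependent {vec i}"
    using v(2) ij by (simp add: vec_def)
  then obtain \<phi> where \<phi>: "Vector_Spaces.linear s (*) \<phi>" "\<phi> (vec i) = (1 :: complex)"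
    using functional.linear_independent_extend[of "{vec i}" "\<lambda>_. 1"] by auto
  interpret \<phi>: Vector_Spaces.linear s "(*)" \<phi> by (rule \<phi>(1))
  let ?M = "interval_rep (i, j)"
  define f where "f k x = (if i \<le> k \<and> k \<le> j then \<phi> (path_map V i (k - i) x) else 0)" for k x
  have f_vec: "f k (vec k) = 1" if "i \<le> k" "k \<le> j" for k
    using path_map_add[of V i "k - i" "j - k" v] that \<phi>(2) by (simp add: f_def vec_def)
  have f_linear: "linear_between s (*) (sp V k) (sp ?M k) (f k)" if "k \<in> {1..n}" for k
    using lin_i[of k] that by (auto simp: linear_between_def f_def interval_rep_def \<phi>.add \<phi>.scale)
  have f_commutes: "f k (mp V k x) = mp ?M k (f (k + 1) x)" if "k \<in> {1..<n}" "x \<in> sp V (k + 1)" for k x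
  proof -
    consider "k < i" | "i \<le> k" "k < j" | "k = j" | "j < k" by linarith
    then show ?thesis
    proof cases
      case 2
      then have "path_map V i (k - i) (mp V k x) = path_map V i (Suc k - i) x"
        by (simp add: Suc_diff_le)
      then show ?thesis using 2 by (simp add: f_def interval_rep_def)
    next
      case 3
      then have "path_map V i d (mp V k x) = path_map V i (Suc d) x"
        by (simp add: j_def)
      also have "\<dots> = 0" using longer[of i x] that 3 i by (simp add: j_def)
      finally show ?thesis using 3 ij by (simp add: f_def interval_rep_def \<phi>.zero)
    qed (auto simp: f_def interval_rep_def)
  qed
  \<comment> \<open>\<open>U\<close> is the copy of the interval spanned by \<open>v\<close>, and \<open>W\<close> is the kernel of \<open>f\<close>\<close>
  define U where "U k = (if i \<le> k \<and> k \<le> j then range (\<lambda>c. s c (vec k)) else {0})" for k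
  define W where "W k = {x \<in> sp V k. f k x = 0}" for k
  have f_add: "f k (x + y) = f k x + f k y"
    if "k \<in> {1..n}" "x \<in> sp V k" "y \<in> sp V k" for k x y
    using f_linear[OF that(1)] that by (auto simp: linear_between_def)
  have f_scale: "f k (s c x) = c * f k x" if "k \<in> {1..n}" "x \<in> sp V k" for k x c
    using f_linear[OF that(1)] that by (auto simp: linear_between_def)
  have f_0: "f k 0 = 0" if "k \<in> {1..n}" for k
    using f_scale[OF that zero_in, of 0] that by simp
  have U_subspace: "subspace (U k)" for k
    by (auto simp: U_def subspace_def image_iff simp flip: scale_left_distrib)
  have U_sub: "is_subrep s n V U"
    unfolding is_subrep_def
  proof (intro conjI ballI)
    fix k assume k: "k \<in> {1..n}"
    show "subspace (U k)" by (rule U_subspace)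
    show "U k \<subseteq> sp V k"
      using k vec_in[of k] subspace_qrep[OF V k] zero_in[OF k]
      by (auto simp: U_def subspace_scale)
  next
    fix k assume k: "k \<in> {1..<n}"
    have "mp V k x \<in> U k" if x: "x \<in> U (k + 1)" for x
    proof (cases "i \<le> k + 1 \<and> k + 1 \<le> j")
      case True
      then obtain c where c: "x = s c (vec (k + 1))" using x by (auto simp: U_def)
      have "mp V k (vec (k + 1)) = path_map V k (Suc (j - Suc k)) v"
        unfolding vec_def using mp_path_map[of V k "j - Suc k" v] by simp
      also have "\<dots> = (if i \<le> k then vec k else 0)"
      proof (cases "i \<le> k")
        case True
        moreover have "Suc (j - Suc k) = j - k" using \<open>i \<le> k + 1 \<and> k + 1 \<le> j\<close> by linarith
        ultimately show ?thesis by (simp only: vec_def if_True)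
      next
        case False
        then have "i = Suc k" using True by simp
        moreover from this have "j - Suc k = d" "k + Suc d = j" using ij by (auto simp: j_def)
        moreover from this have "path_map V k (Suc d) v = 0"
          using longer[of k v] k v(1) ij(2) unfolding j_def[symmetric] by simp
        ultimately show ?thesis by (simp only:) simp
      qed
      also have "\<dots> \<in> U k"
        using True range_eqI[of "vec k" "\<lambda>c. s c (vec k)" 1] subspace_0[OF U_subspace]
        by (simp add: U_def)
      finally have "mp V k (vec (k + 1)) \<in> U k" .
      then have "s c (mp V k (vec (k + 1))) \<in> U k" by (rule subspace_scale[OF U_subspace])
      moreover have "mp V k x = s c (mp V k (vec (k + 1)))"
        using mp_homogeneous(2)[OF V, of k "vec (k + 1)" c] k vec_in[of "k + 1"] True c by simp
      ultimately show ?thesis by simp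
    next
      case False
      then have "x = 0" using x by (auto simp: U_def split: if_splits)
      moreover have "mp V k 0 = 0"
        using mp_homogeneous(2)[OF V, of k 0 0] k zero_in[of "Suc k"] by simp
      ultimately show ?thesis using subspace_0[OF U_subspace] by simp
    qed
    then show "mp V k ` U (k + 1) \<subseteq> U k" by blast
  qed
  have W_sub: "is_subrep s n V W"
    unfolding is_subrep_def
  proof (intro conjI ballI)
    fix k assume k: "k \<in> {1..n}"
    show "subspace (W k)"
      using subspace_qrep[OF V k] f_add[OF k] f_scale[OF k] f_0[OF k]
      by (auto simp: W_def subspace_def)
    show "W k \<subseteq> sp V k" by (auto simp: W_def)
  next
    fix k assume k: "k \<in> {1..<n}"
    show "mp V k ` W (k + 1) \<subseteq> W k"
    proof
      fix y assume "y \<in> mp V k ` W (k + 1)"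
      then obtain x where x: "x \<in> sp V (k + 1)" "f (k + 1) x = 0" "y = mp V k x"
        by (auto simp: W_def)
      then show "y \<in> W k"
        using f_commutes[OF k x(1)] mp_homogeneous(1)[OF V, of k x] k
        by (auto simp: W_def interval_rep_def)
    qed
  qed
  have sum: "sp V k = {u + w | u w. u \<in> U k \<and> w \<in> W k}" and int: "U k \<inter> W k = {0}"
    if k: "k \<in> {1..n}" for k
  proof -
    note sub = subspace_qrep[OF V k]
    have UW: "U k \<subseteq> sp V k" "W k \<subseteq> sp V k" "0 \<in> U k" "0 \<in> W k"
      using U_sub W_sub k by (auto simp: is_subrep_def intro: subspace_0)
    have "\<exists>u w. x = u + w \<and> u \<in> U k \<and> w \<in> W k" if x: "x \<in> sp V k" for x
    proof (cases "i \<le> k \<and> k \<le> j")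
      case True
      have vec: "vec k \<in> sp V k" using vec_in[of k] True k by simp
      have u: "s c (vec k) \<in> sp V k" for c
        using sub vec by (rule subspace_scale)
      \<comment> \<open>subtracting the component of \<open>x\<close> along \<open>vec k\<close> leaves an element of the kernel\<close>
      have "f k (x + s (- f k x) (vec k)) = f k x + (- f k x) * f k (vec k)"
        by (simp only: f_add[OF k x u] f_scale[OF k vec])
      then have "f k (x + s (- f k x) (vec k)) = 0"
        using f_vec[of k] True by simp
      moreover have "x + s (- f k x) (vec k) \<in> sp V k"
        using sub x u by (intro subspace_add)
      ultimately have "x + s (- f k x) (vec k) \<in> W k" by (simp add: W_def)
      moreover have "s (f k x) (vec k) \<in> U k" using True by (auto simp: U_def)
      moreover have "x = s (f k x) (vec k) + (x + s (- f k x) (vec k))" by simp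
      ultimately show ?thesis by blast
    next
      case False
      then have "x \<in> W k" using x by (auto simp: W_def f_def)
      then show ?thesis using UW(3) by (intro exI[of _ 0] exI[of _ x]) auto
    qed
    then show "sp V k = {u + w | u w. u \<in> U k \<and> w \<in> W k}"
      using UW subspace_add[OF sub] by blast
    have "x = 0" if x: "x \<in> U k" "x \<in> W k" for x
    proof (cases "i \<le> k \<and> k \<le> j")
      case True
      then obtain c where "x = s c (vec k)" using x(1) by (auto simp: U_def)
      moreover have "f k (s c (vec k)) = c"
        using f_scale[OF k vec_in, of c] f_vec[of k] True k by simp
      ultimately show ?thesis using x(2) by (simp add: W_def)
    next
      case False
      then show ?thesis using that by (auto simp: U_def split: if_splits)
    qed
    then show "U k \<inter> W k = {0}" using UW by blast
  qed
  have "\<forall>k\<in>{1..n}. sp V k = {u + w | u w. u \<in> U k \<and> w \<in> W k} \<and> U k \<inter> W k = {0}"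
    by (intro ballI conjI sum int)
  with U_sub W_sub have "zero_spaces n U \<or> zero_spaces n W"
    using indec[unfolded indecomposable_def, THEN conjunct2, THEN spec[of _ U], THEN spec[of _ W]]
    by iprover
  moreover have "\<not> zero_spaces n U"
  proof
    assume "zero_spaces n U"
    then have "U i = {0}" using i by (simp add: zero_spaces_def)
    moreover have "s 1 (vec i) \<in> U i" using ij by (auto simp: U_def simp del: scale_one)
    ultimately show False using v(2) ij by (simp add: vec_def)
  qed
  ultimately have "zero_spaces n W" by blast
  then have W0: "W k = {0}" if "k \<in> {1..n}" for k
    using that by (simp add: zero_spaces_def)
  have "bij_betw (f k) (sp V k) (sp ?M k)" if k: "k \<in> {1..n}" for k
  proof (rule bij_betwI')
    fix x y assume xy: "x \<in> sp V k" "y \<in> sp V k"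
    note sub = subspace_qrep[OF V k]
    have ny: "s (- 1) y \<in> sp V k" using sub xy by (intro subspace_scale)
    show "f k x = f k y \<longleftrightarrow> x = y"
    proof
      assume "f k x = f k y"
      then have "f k (x + s (- 1) y) = 0"
        using f_add[OF k xy(1) ny] f_scale[OF k xy(2), of "- 1"] by simp
      then have "x + s (- 1) y \<in> W k"
        using subspace_add[OF sub xy(1) ny] by (simp add: W_def)
      then show "x = y" using W0[OF k] by simp
    qed simp
  next
    fix x assume "x \<in> sp V k"
    then show "f k x \<in> sp ?M k" using f_linear[OF k] unfolding linear_between_def by blast
  next
    fix c assume c: "c \<in> sp ?M k"
    show "\<exists>x \<in> sp V k. c = f k x"
    proof (cases "i \<le> k \<and> k \<le> j")
      case True
      then have vec: "vec k \<in> sp V k" using vec_in[of k] k by simp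
      have "f k (s c (vec k)) = c" using f_scale[OF k vec, of c] f_vec[of k] True by simp
      moreover have "s c (vec k) \<in> sp V k"
        using subspace_qrep[OF V k] vec by (rule subspace_scale)
      ultimately show ?thesis by metis
    next
      case False
      then show ?thesis using c f_0[OF k] zero_in[OF k] by (auto simp: interval_rep_def)
    qed
  qed
  then have "qrep_iso s (*) n V ?M"
    unfolding qrep_iso_def by (intro exI[of _ f] conjI ballI f_linear f_commutes)
  moreover have "v \<in> sp V j" "path_map V i (j - i) v \<noteq> 0" using v ij(3) by (auto simp: j_def)
  ultimately show ?thesis using i(1) ij(1,2) by blast
qed

lemma vector_space_complex: "vector_space ((*) :: complex \<Rightarrow> complex \<Rightarrow> complex)"
  by unfold_locales (auto simp: algebra_simps)

lemma is_qrep_interval_rep: "is_qrep (*) n (interval_rep (i, j))"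
proof -
  interpret vector_space "(*) :: complex \<Rightarrow> complex \<Rightarrow> complex" by (rule vector_space_complex)
  have "span {1} = (UNIV :: complex set)"
    by (auto simp: span_singleton image_iff)
  then have "sp (interval_rep (i, j)) k = span (if i \<le> k \<and> k \<le> j then {1} else {})" for k
    by (simp add: interval_rep_def)
  then have "\<exists>B. finite B \<and> sp (interval_rep (i, j)) k = span B" for k
    by (metis finite.emptyI finite.insertI)
  then show ?thesis
    by (auto simp: is_qrep_def linear_between_def interval_rep_def)
qed

lemma path_map_interval_rep:
  "path_map (interval_rep (i, j)) t d z = (if d = 0 \<or> i \<le> t \<and> t + d \<le> j then z else 0)"
proof (induction d arbitrary: z)
  case (Suc d)
  have "path_map (interval_rep (i, j)) t (Suc d) z
      = path_map (interval_rep (i, j)) t d (if i \<le> t + d \<and> t + d + 1 \<le> j then z else 0)"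
    by (simp add: interval_rep_def)
  then show ?case unfolding Suc by auto
qed simp

lemma subspace_complex:
  assumes "module.subspace ((*) :: complex \<Rightarrow> complex \<Rightarrow> complex) A"
  shows "A = {0} \<or> A = UNIV"
proof -
  interpret vector_space "(*) :: complex \<Rightarrow> complex \<Rightarrow> complex" by (rule vector_space_complex)
  have "0 \<in> A" by (rule subspace_0[OF assms])
  moreover have "z \<in> A" if "x \<in> A" "x \<noteq> 0" for x z
    using subspace_scale[OF assms that(1), of "z / x"] that by simp
  ultimately show ?thesis by blast
qed

text \<open>A decomposition of \<open>M\<^sub>i\<^sub>,\<^sub>j\<close> has a full line in exactly one summand at every vertex of
  \<open>{i..j}\<close>.  Following the arrows down from \<open>j\<close>, the full line stays in the same summand, so the
  other one vanishes.\<close>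

lemma indecomposable_interval_rep:
  assumes "1 \<le> i" "i \<le> j" "j \<le> n"
  shows "indecomposable (*) n (interval_rep (i, j))"
proof -
  let ?M = "interval_rep (i, j)"
  interpret vector_space "(*) :: complex \<Rightarrow> complex \<Rightarrow> complex" by (rule vector_space_complex)
  have sp: "sp ?M k = (if i \<le> k \<and> k \<le> j then UNIV else {0})" for k
    by (simp add: interval_rep_def)
  have full: "U k = UNIV" if U: "is_subrep (*) n ?M U" "U j = UNIV" and k: "i \<le> k" "k \<le> j" for U k
    using k(2) k(1)
  proof (induction k rule: inc_induct)
    case base
    show ?case by (rule U(2))
  next
    case (step k)
    then have "k \<in> {1..<n}" using assms by simp
    then have "mp ?M k ` U (k + 1) \<subseteq> U k" using U(1) unfolding is_subrep_def by blast
    moreover have "mp ?M k = (\<lambda>z. z)" using step by (simp add: interval_rep_def)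
    ultimately show ?case using step by auto
  qed
  have vanish: "zero_spaces n W"
    if U: "is_subrep (*) n ?M U" "U j = UNIV" and W: "is_subrep (*) n ?M W"
      and int: "\<And>k. k \<in> {1..n} \<Longrightarrow> U k \<inter> W k = {0}" for U W
    unfolding zero_spaces_def
  proof
    fix k assume k: "k \<in> {1..n}"
    show "W k = {0}"
    proof (cases "i \<le> k \<and> k \<le> j")
      case True
      then show ?thesis using full[OF U, of k] int[OF k] by simp
    next
      case False
      then have "sp ?M k = {0}" by (auto simp: sp)
      moreover have "subspace (W k)" "W k \<subseteq> sp ?M k" using W k unfolding is_subrep_def by blast+
      ultimately have "W k \<subseteq> {0}" "0 \<in> W k" by (auto intro: subspace_0)
      then show ?thesis by blast
    qed
  qed
  have "zero_spaces n U \<or> zero_spaces n W"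
    if UW: "is_subrep (*) n ?M U" "is_subrep (*) n ?M W"
      and sum: "\<And>k. k \<in> {1..n} \<Longrightarrow> sp ?M k = {u + w | u w. u \<in> U k \<and> w \<in> W k}"
      and int: "\<And>k. k \<in> {1..n} \<Longrightarrow> U k \<inter> W k = {0}" for U W
  proof -
    have j: "j \<in> {1..n}" using assms by simp
    have "subspace (U j)" "subspace (W j)" using UW j by (auto simp: is_subrep_def)
    then have cases: "U j = {0} \<or> U j = UNIV" "W j = {0} \<or> W j = UNIV"
      by (auto dest: subspace_complex)
    have "(1 :: complex) \<in> sp ?M j" using assms by (simp add: sp)
    then have "\<not> (U j = {0} \<and> W j = {0})" unfolding sum[OF j] by auto
    then consider "U j = UNIV" | "W j = UNIV" using cases by blast
    then show ?thesis
    proof cases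
      case 1
      then show ?thesis using vanish[OF UW(1) _ UW(2)] int by blast
    next
      case 2
      then show ?thesis using vanish[OF UW(2) _ UW(1)] int by (simp add: Int_commute)
    qed
  qed
  moreover have "\<not> zero_spaces n (sp ?M)"
  proof
    assume "zero_spaces n (sp ?M)"
    then have "sp ?M i = {0}" using assms by (simp add: zero_spaces_def)
    then have "(1 :: complex) \<in> {0}" using sp[of i] assms by auto
    then show False by simp
  qed
  ultimately show ?thesis unfolding indecomposable_def by blast
qed

text \<open>An isomorphism preserves the set of vertices with nonzero space, here the interval.\<close>

lemma interval_rep_iso_imp_eq:
  assumes iso: "qrep_iso (*) (*) n (interval_rep (i, j)) (interval_rep (i', j'))"
    and "1 \<le> i" "i \<le> j" "j \<le> n" "1 \<le> i'" "i' \<le> j'" "j' \<le> n"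
  shows "(i, j) = (i', j')"
proof -
  have "k \<in> {i..j} \<longleftrightarrow> k \<in> {i'..j'}" if "k \<in> {1..n}" for k
  proof -
    have no_bij: "\<not> bij_betw g (UNIV :: complex set) {0 :: complex}"
      "\<not> bij_betw g {0 :: complex} (UNIV :: complex set)" for g
      using bij_betw_finite[of g UNIV "{0}"] bij_betw_finite[of g "{0}" UNIV] infinite_UNIV_char_0
      by auto
    from iso obtain f where
      "\<forall>k\<in>{1..n}. linear_between (*) (*) (sp (interval_rep (i, j)) k) (sp (interval_rep (i', j')) k) (f k) \<and>
         bij_betw (f k) (sp (interval_rep (i, j)) k) (sp (interval_rep (i', j')) k)"
      unfolding qrep_iso_def by (elim exE conjE)
    from bspec[OF this that]
    have "bij_betw (f k) (sp (interval_rep (i, j)) k) (sp (interval_rep (i', j')) k)" ..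
    moreover have "sp (interval_rep (a, b)) k = (if k \<in> {a..b} then UNIV else {0})" for a b
      by (simp add: interval_rep_def)
    ultimately show ?thesis
      using no_bij[of "f k"] by (metis (full_types))
  qed
  moreover have "{i..j} \<subseteq> {1..n}" "{i'..j'} \<subseteq> {1..n}" using assms by auto
  ultimately have "{i..j} = {i'..j'}" by blast
  then show ?thesis using assms by (simp add: Icc_eq_Icc)
qed

text \<open>To see the effect of a single path, let it act on a family concentrated at its source.\<close>

lemma basis_path_kills:
  assumes "vector_space s" and V: "is_quotient_module s n I V" and path: "basis_path (j, i) \<in> I"
    and ij: "1 \<le> i" "i \<le> j" "j \<le> n" and v: "v \<in> sp V j"
  shows "path_map V i (j - i) v = 0"
proof -
  interpret complex_vector_space s
    using assms(1) by (simp add: complex_vector_space_def)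
  have rep: "is_qrep s n V" using V by (simp add: is_quotient_module_def)
  define w where "w k = (if k = j then v else 0)" for k
  have w: "\<forall>k \<in> {1..n}. w k \<in> sp V k"
    using v subspace_0[OF subspace_qrep[OF rep]] by (auto simp: w_def)
  have "qrep_act s n V (basis_path (j, i)) w i
      = (\<Sum>k\<in>{i..n}. if k = j then path_map V i (j - i) v else 0)"
    unfolding qrep_act_def by (intro sum.cong) (auto simp: basis_path_def w_def)
  also have "\<dots> = path_map V i (j - i) v" using ij by simp
  finally show ?thesis using V path w ij by (auto simp: is_quotient_module_def)
qed

section \<open>The ideal of a Dyck path\<close>

text \<open>The valley \<open>(a, b)\<close> gives the shortest path into \<open>a - 1\<close> that starts above the height of the
  down step there; among the vertices whose down steps have the same height, \<open>a - 1\<close> is the last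
  one, so the paths into the others that start above this height pass through it.\<close>

lemma dyck_ideal_eq_long_paths:
  assumes D: "D \<in> dyck_paths n"
  shows "dyck_ideal n D = long_paths n (down_height D)"
proof
  let ?G = "{basis_path (b + 1, a - 1) | a b. (a, b) \<in> valleys D}"
  interpret ring "path_algebra n" by (rule ring_path_algebra)
  have long: "ideal (long_paths n (down_height D)) (path_algebra n)"
    using down_height_mono[OF D] by (rule ideal_long_paths)
  have G: "?G \<subseteq> long_paths n (down_height D)"
  proof
    fix g assume "g \<in> ?G"
    then obtain a b where g: "g = basis_path (b + 1, a - 1)" and v: "(a, b) \<in> valleys D" by blast
    note h = valley_height[OF D v]
    have "a - 1 \<le> b" using down_height_bounds(1)[OF D, of "a - 1"] h by simp
    then show "g \<in> long_paths n (down_height D)"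
      unfolding g basis_path_in_long_paths using h by (auto simp: qpaths_def)
  qed
  show "dyck_ideal n D \<subseteq> long_paths n (down_height D)"
    unfolding dyck_ideal_def using long G by (rule genideal_minimal)
  have "long_paths n (down_height D) \<subseteq> carrier (path_algebra n)" by (auto simp: long_paths_def)
  with G have Gc: "?G \<subseteq> carrier (path_algebra n)" by (rule order_trans)
  have ideal: "ideal (dyck_ideal n D) (path_algebra n)"
    unfolding dyck_ideal_def using Gc by (rule genideal_ideal)
  have G_in: "?G \<subseteq> dyck_ideal n D"
    unfolding dyck_ideal_def using Gc by (rule genideal_self)
  show "long_paths n (down_height D) \<subseteq> dyck_ideal n D"
  proof
    fix x assume x: "x \<in> long_paths n (down_height D)"
    then have xc: "x \<in> carrier (path_algebra n)" by (simp add: long_paths_def)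
    have "basis_path (s, t) \<in> dyck_ideal n D" if "x (s, t) \<noteq> 0" for s t
    proof -
      have st: "(s, t) \<in> qpaths n" using xc that unfolding carrier_path_algebra by metis
      have h: "down_height D t < s" using x that by (simp add: long_paths_def)
      obtain a where a: "t < a" "(a, down_height D t) \<in> valleys D"
        using ex_valley[OF D, of t] st h by (auto simp: qpaths_def)
      then have "basis_path (down_height D t + 1, a - 1) \<in> dyck_ideal n D" using G_in by blast
      from basis_path_in_ideal_extend[OF ideal this, of s t] show ?thesis
        using a(1) h st by (simp add: qpaths_def)
    qed
    with xc show "x \<in> dyck_ideal n D"
      by (intro iffD2[OF ideal_mem_iff_paths[OF ideal]]) auto
  qed
qed

lemma ideal_dyck_ideal: "D \<in> dyck_paths n \<Longrightarrow> ideal (dyck_ideal n D) (path_algebra n)"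
  by (simp only: dyck_ideal_eq_long_paths) (rule ideal_long_paths, rule down_height_mono)

lemma basis_path_in_dyck_ideal:
  assumes "D \<in> dyck_paths n"
  shows "basis_path (s, t) \<in> dyck_ideal n D \<longleftrightarrow> (s, t) \<in> qpaths n \<and> down_height D t < s"
  by (simp add: dyck_ideal_eq_long_paths[OF assms] basis_path_in_long_paths)

lemma dyck_ideal_without_idempotents:
  assumes D: "D \<in> dyck_paths n"
  shows "dyck_ideal n D \<in> ideals_without_idempotents n"
  unfolding ideals_without_idempotents_def
proof (intro CollectI conjI ballI impI)
  show "ideal (dyck_ideal n D) (path_algebra n)" by (rule ideal_dyck_ideal[OF D])
  fix x assume "x \<in> dyck_ideal n D" and idem: "x \<otimes>\<^bsub>path_algebra n\<^esub> x = x"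
  then have x: "x \<in> carrier (path_algebra n)" "\<And>s t. x (s, t) \<noteq> 0 \<Longrightarrow> down_height D t < s"
    by (auto simp: dyck_ideal_eq_long_paths[OF D] long_paths_def)
  have "x (t, t) = 0" for t
  proof (rule ccontr)
    assume "x (t, t) \<noteq> 0"
    moreover from this have "(t, t) \<in> qpaths n" using x(1) unfolding carrier_path_algebra by metis
    ultimately show False
      using x(2)[of t t] down_height_bounds(1)[OF D, of t] by (simp add: qpaths_def)
  qed
  with x(1) idem show "x = \<zero>\<^bsub>path_algebra n\<^esub>" by (rule strictly_triangular_idempotent)
qed

text \<open>Raising the Dyck path removes paths of the quiver from its ideal.\<close>

lemma dyck_le_iff_ideal_subset:
  assumes D: "D \<in> dyck_paths n" and D': "D' \<in> dyck_paths n"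
  shows "dyck_le n D' D \<longleftrightarrow> dyck_ideal n D \<subseteq> dyck_ideal n D'"
proof
  assume le: "dyck_le n D' D"
  show "dyck_ideal n D \<subseteq> dyck_ideal n D'"
  proof
    fix x assume "x \<in> dyck_ideal n D"
    then have x: "x \<in> carrier (path_algebra n)" "\<And>s t. x (s, t) \<noteq> 0 \<Longrightarrow> down_height D t < s"
      by (auto simp: dyck_ideal_eq_long_paths[OF D] long_paths_def)
    have "down_height D' t < s" if "x (s, t) \<noteq> 0" for s t
    proof -
      have "(s, t) \<in> qpaths n" using x(1) that unfolding carrier_path_algebra by metis
      then have "down_height D' t \<le> down_height D t" using le by (auto simp: dyck_le_def qpaths_def)
      with x(2)[OF that] show ?thesis by simp
    qed
    with x(1) show "x \<in> dyck_ideal n D'"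
      by (auto simp: dyck_ideal_eq_long_paths[OF D'] long_paths_def)
  qed
next
  assume sub: "dyck_ideal n D \<subseteq> dyck_ideal n D'"
  show "dyck_le n D' D"
    unfolding dyck_le_def
  proof (intro ballI, rule ccontr)
    fix t assume t: "t \<in> {1..n}" and "\<not> down_height D' t \<le> down_height D t"
    \<comment> \<open>the path from \<open>down_height D' t\<close> to \<open>t\<close> separates the two ideals\<close>
    then have "basis_path (down_height D' t, t) \<in> dyck_ideal n D"
      using down_height_bounds[OF D' t] by (simp add: basis_path_in_dyck_ideal[OF D] qpaths_def)
    with sub have "basis_path (down_height D' t, t) \<in> dyck_ideal n D'" by blast
    then show False by (simp add: basis_path_in_dyck_ideal[OF D'])
  qed
qed

lemma inj_on_dyck_ideal: "inj_on (dyck_ideal n) (dyck_paths n)"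
proof (rule inj_onI)
  fix D D' assume D: "D \<in> dyck_paths n" and D': "D' \<in> dyck_paths n"
    and "dyck_ideal n D = dyck_ideal n D'"
  then have "dyck_le n D' D" "dyck_le n D D'"
    by (simp_all add: dyck_le_iff_ideal_subset)
  then show "D = D'"
    using D D' by (intro dyck_path_eqI) (auto simp: dyck_le_def intro: order_antisym)
qed

text \<open>The height of the down step at \<open>t\<close> is read off an ideal as the largest \<open>s\<close> such that the path
  from \<open>s\<close> to \<open>t\<close> is missing.  Such an \<open>s\<close> exists since trivial paths are idempotent, and these
  heights increase since an ideal contains every extension of each of its paths.\<close>

lemma ideal_eq_dyck_ideal:
  assumes I: "I \<in> ideals_without_idempotents n"
  shows "\<exists>D \<in> dyck_paths n. I = dyck_ideal n D"
proof -
  have ideal: "ideal I (path_algebra n)" using I by (simp add: ideals_without_idempotents_def)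
  define A where "A t = {s \<in> {t..n}. basis_path (s, t) \<notin> I}" for t
  define k where "k t = Max (A t)" for t
  have fin: "finite (A t)" for t by (simp add: A_def)
  have A: "t \<in> A t" if "t \<in> {1..n}" for t
    using trivial_path_notin[OF I that] that by (simp add: A_def)
  have k_in: "k t \<in> A t" if "t \<in> {1..n}" for t
    unfolding k_def using fin A[OF that] by (intro Max_in) auto
  have mem_iff: "basis_path (s, t) \<in> I \<longleftrightarrow> k t < s" if "(s, t) \<in> qpaths n" for s t
  proof
    have t: "t \<in> {1..n}" and s: "t \<le> s" "s \<le> n" using that by (auto simp: qpaths_def)
    show "k t < s" if path: "basis_path (s, t) \<in> I"
    proof (rule ccontr)
      assume "\<not> k t < s"
      then have "basis_path (k t, t) \<in> I"
        using k_in[OF t] t by (intro basis_path_in_ideal_extend[OF ideal path]) (auto simp: A_def)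
      then show False using k_in[OF t] by (simp add: A_def)
    qed
    show "basis_path (s, t) \<in> I" if "k t < s"
    proof (rule ccontr)
      assume "basis_path (s, t) \<notin> I"
      then have "s \<in> A t" using s by (simp add: A_def)
      then show False using Max_ge[OF fin, of s t] that by (simp add: k_def)
    qed
  qed
  have bounds: "t \<le> k t \<and> k t \<le> n" if "t \<in> {1..n}" for t
    using k_in[OF that] by (simp add: A_def)
  have mono: "k t \<le> k u" if tu: "1 \<le> t" "t \<le> u" "u \<le> n" for t u
  proof (rule ccontr)
    assume less: "\<not> k t \<le> k u"
    have k: "k t \<le> n" "u \<le> k u" using bounds[of t] bounds[of u] tu by auto
    have "basis_path (k t, u) \<in> I"
      using mem_iff[of "k t" u] less k tu by (simp add: qpaths_def)
    from basis_path_in_ideal_extend[OF ideal this, of "k t" t] have "basis_path (k t, t) \<in> I"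
      using k tu by simp
    moreover have "k t \<in> A t" using k_in[of t] tu by simp
    ultimately show False by (simp add: A_def)
  qed
  obtain D where D: "D \<in> dyck_paths n" and height: "\<And>t. t \<in> {1..n} \<Longrightarrow> down_height D t = k t"
    using ex_dyck_path[OF bounds mono] by blast
  have same: "basis_path (s, t) \<in> I \<longleftrightarrow> basis_path (s, t) \<in> dyck_ideal n D"
    if "(s, t) \<in> qpaths n" for s t
    using mem_iff[OF that] height[of t] that
    by (auto simp: basis_path_in_dyck_ideal[OF D] qpaths_def)
  have "x \<in> I \<longleftrightarrow> x \<in> dyck_ideal n D" for x
  proof -
    have "basis_path p \<in> I \<longleftrightarrow> basis_path p \<in> dyck_ideal n D"
      if "x \<in> carrier (path_algebra n)" "x p \<noteq> 0" for p
    proof -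
      have "p \<in> qpaths n" using that unfolding carrier_path_algebra by metis
      then show ?thesis using same[of "fst p" "snd p"] by simp
    qed
    then show ?thesis
      using ideal_mem_iff_paths[OF ideal, of x] ideal_mem_iff_paths[OF ideal_dyck_ideal[OF D], of x]
      by blast
  qed
  with D show ?thesis by blast
qed

lemma bij_betw_dyck_ideal:
  "bij_betw (dyck_ideal n) (dyck_paths n) (ideals_without_idempotents n)"
  unfolding bij_betw_def
  using inj_on_dyck_ideal dyck_ideal_without_idempotents ideal_eq_dyck_ideal by blast

section \<open>Modules over the quotient by the ideal of a Dyck path\<close>

text \<open>A path from \<open>s\<close> to \<open>t\<close> acts nontrivially on \<open>M\<^sub>i\<^sub>,\<^sub>j\<close> only if \<open>i \<le> t \<le> s \<le> j\<close>; if \<open>(i, j)\<close> is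
  on or below \<open>D\<close>, then \<open>s \<le> j\<close> does not exceed the height at \<open>t\<close> and this path is not in the ideal.\<close>

lemma is_quotient_module_interval_rep:
  assumes D: "D \<in> dyck_paths n" and p: "(i, j) \<in> points_below n D"
  shows "is_quotient_module (*) n (dyck_ideal n D) (interval_rep (i, j))"
  unfolding is_quotient_module_def
proof (intro conjI ballI allI impI)
  show "is_qrep (*) n (interval_rep (i, j))" by (rule is_qrep_interval_rep)
  fix x v t
  assume x: "x \<in> dyck_ideal n D" and v: "\<forall>k\<in>{1..n}. v k \<in> sp (interval_rep (i, j)) k"
    and t: "t \<in> {1..n}"
  have ij: "1 \<le> i" "i \<le> j" "j \<le> n" "j \<le> down_height D i" using p by (auto simp: points_below_def)
  have "x (k, t) * path_map (interval_rep (i, j)) t (k - t) (v k) = 0" if k: "k \<in> {t..n}" for k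
  proof (cases "i \<le> t \<and> k \<le> j")
    case True
    then have "k \<le> down_height D t"
      using ij down_height_mono[OF D, of i t] t by auto
    then have "\<not> down_height D t < k" by simp
    then have "x (k, t) = 0"
      using x unfolding dyck_ideal_eq_long_paths[OF D] long_paths_def by blast
    then show ?thesis by simp
  next
    case False
    have "v k \<in> sp (interval_rep (i, j)) k" using v k t by simp
    then have "i \<le> k \<and> k \<le> j \<or> v k = 0"
      by (auto simp: interval_rep_def split: if_splits)
    then show ?thesis using False k by (auto simp: path_map_interval_rep)
  qed
  then show "qrep_act (*) n (interval_rep (i, j)) x v t = 0"
    unfolding qrep_act_def by (intro sum.neutral) blast
qed

text \<open>The interval found in \<open>V\<close> comes with a nonzero path map from \<open>V\<^sub>j\<close> to \<open>V\<^sub>i\<close>.  The path from \<open>j\<close>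
  to \<open>i\<close> is therefore not in the ideal, which says that \<open>(i, j)\<close> lies on or below \<open>D\<close>.\<close>

lemma indecomposable_quotient_module:
  assumes s: "vector_space s" and D: "D \<in> dyck_paths n"
    and V: "is_quotient_module s n (dyck_ideal n D) V" "indecomposable s n V"
  shows "\<exists>p \<in> points_below n D. qrep_iso s (*) n V (interval_rep p)"
proof -
  have "is_qrep s n V" using V(1) by (simp add: is_quotient_module_def)
  from indecomposable_is_interval[OF s this V(2)] obtain i j v
    where ij: "1 \<le> i" "i \<le> j" "j \<le> n" and v: "v \<in> sp V j" "path_map V i (j - i) v \<noteq> 0"
      and iso: "qrep_iso s (*) n V (interval_rep (i, j))" by blast
  have "basis_path (j, i) \<notin> dyck_ideal n D"
    using basis_path_kills[OF s V(1) _ ij v(1)] v(2) by blast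
  then have "(i, j) \<in> points_below n D"
    using ij by (auto simp: basis_path_in_dyck_ideal[OF D] qpaths_def points_below_def)
  with iso show ?thesis by blast
qed

theorem proposition2p3:
  fixes n :: nat and s :: "complex \<Rightarrow> 'v::ab_group_add \<Rightarrow> 'v"
  assumes "n \<ge> 1" and "vector_space s"
  shows "bij_betw (dyck_ideal n) (dyck_paths n) (ideals_without_idempotents n) \<and>
    (\<forall>D \<in> dyck_paths n. \<forall>D' \<in> dyck_paths n.
       dyck_le n D' D \<longleftrightarrow> dyck_ideal n D \<subseteq> dyck_ideal n D') \<and>
    (\<forall>D \<in> dyck_paths n.
       (\<forall>p \<in> points_below n D. is_quotient_module (*) n (dyck_ideal n D) (interval_rep p) \<and>
          indecomposable (*) n (interval_rep p)) \<and>
       (\<forall>p \<in> points_below n D. \<forall>q \<in> points_below n D.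
          qrep_iso (*) (*) n (interval_rep p) (interval_rep q) \<longrightarrow> p = q) \<and>
       (\<forall>V :: 'v qrep. is_quotient_module s n (dyck_ideal n D) V \<and> indecomposable s n V \<longrightarrow>
          (\<exists>p \<in> points_below n D. qrep_iso s (*) n V (interval_rep p))))"
proof (intro conjI ballI allI impI)
  show "bij_betw (dyck_ideal n) (dyck_paths n) (ideals_without_idempotents n)"
    by (rule bij_betw_dyck_ideal)
next
  fix D D' assume "D \<in> dyck_paths n" "D' \<in> dyck_paths n"
  then show "dyck_le n D' D \<longleftrightarrow> dyck_ideal n D \<subseteq> dyck_ideal n D'"
    by (rule dyck_le_iff_ideal_subset)
next
  fix D p assume D: "D \<in> dyck_paths n" and p: "p \<in> points_below n D"
  obtain i j where ij: "p = (i, j)" by (cases p)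
  show "is_quotient_module (*) n (dyck_ideal n D) (interval_rep p)"
    using D p unfolding ij by (rule is_quotient_module_interval_rep)
  show "indecomposable (*) n (interval_rep p)"
    using p unfolding ij by (intro indecomposable_interval_rep) (auto simp: points_below_def)
next
  fix D p q assume pq: "p \<in> points_below n D" "q \<in> points_below n D"
    and iso: "qrep_iso (*) (*) n (interval_rep p) (interval_rep q)"
  obtain i j i' j' where ij: "p = (i, j)" "q = (i', j')" by (cases p, cases q)
  show "p = q"
    using interval_rep_iso_imp_eq[OF iso[unfolded ij]] pq unfolding ij
    by (auto simp: points_below_def)
next
  fix D and V :: "'v qrep"
  assume "D \<in> dyck_paths n" "is_quotient_module s n (dyck_ideal n D) V \<and> indecomposable s n V"
  then show "\<exists>p \<in> points_below n D. qrep_iso s (*) n V (interval_rep p)"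
    using indecomposable_quotient_module[OF assms(2)] by blast
qed

end
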